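(* In the setting of perturbed problems described in the context, define $$\bar\beta=\left.\frac{d}{dt}\gamma(t,0)\right|_{t=0},\qquad \rho(u)=\left.\frac{d}{dt}\gamma(0,tu)\right|_{t=0},\qquad \tilde g^u(x)=g^u(x)+W_{\rho(u)}(x)\qquad(u\in\mathbb{C}^d).$$ Then (in the sense of formal series) the system $\frac{d}{dt}x=g(x)+f(x)$ may be rewritten in the form $$\frac{d}{dt} x = g(x)+f(x) = \tilde g^v(x) + W_{\bar \beta}(x).$$ The vector fields $\tilde g^v(x)$ and $W_{\bar \beta}(x)$ commute with each other, with $g(x)+f(x)$, and with $\tilde g^u(x)$ for arbitrary $u\in\mathbb{C}^d$.
   Context: Setting. $g_1,\dots,g_d$ are linearly independent vector fields on $\mathbb{C}^D$ that commute with each other, $[g_j,g_k]=0$, where $[a,b](x)=b'(x)a(x)-a'(x)b(x)$ (two vector fields commute if their bracket vanishes; for formal series the bracket is expanded formally). For $u=(u_1,\dots,u_d)\in\mathbb{C}^d$, $g^u=\sum_{j=1}^d u_jg_j$. $A$ (the alphabet) is a finite or countable set that is an additive commutative monoid with neutral element $\mathbf{0}$; for each $\ell\in A$ there is a vector field $f_\ell:\mathbb{C}^D\to\mathbb{C}^D$, and there are numbers $\nu_{j,\ell}\in\mathbb{C}$ with $[g_j,f_\ell]=\nu_{j,\ell}f_\ell$ and $\nu_{j,\ell+\ell'}=\nu_{j,\ell}+\nu_{j,\ell'}$ for $j=1,\dots,d$, $\ell,\ell'\in A$ (so $\nu_{j,\mathbf{0}}=0$). The vector fields $f,g:\mathbb{C}^D\to\mathbb{C}^D$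 satisfy $f=\sum_{\ell\in A}f_\ell$ and $g=g^v$ for some $v\in\mathbb{C}^d$. Notation: $\nu_\ell^u=u_1\nu_{1,\ell}+\cdots+u_d\nu_{d,\ell}$. The vector $v$ is nonresonant: for $\ell\in A$, $\nu_\ell^v=0$ if and only if $\ell=\mathbf{0}$. All maps are assumed smooth. Word series. $\mathcal{W}$ is the set of all words (including the empty word $\emptyset$) with letters in $A$. The word basis functions are $f_\emptyset(x)=x$, $f_\ell(x)$ for one-letter words, and $f_{\ell_1\cdots\ell_n}(x)=f'_{\ell_2\cdots\ell_n}(x)f_{\ell_1}(x)$ for $n>1$ (with $f'$ the Jacobian matrix). For $\delta:\mathcal{W}\to\mathbb{C}$, $W_\delta(x)=\sum_{w\in\mathcal{W}}\delta_wf_w(x)$, a formal series; all identities are understood formally (no convergence asserted). Derivatives of $\gamma$ are taken word by word. Definition of $\gamma(\tau,u)$, $\tau\in\mathbb{R}$, $u\in\mathbb{C}^d$ (arguments omitted; $\mathbf{0}^r$ is the word of $r$ letters $\mathbf{0}$; $(\ell_0+\ell_1)$ is a single letter): $\gamma_\emptyset=1$ and, for $r\ge1$, $\ell_0\in A\setminus\{\mathbf{0}\}$, $n\ge1$, $\ell_1,\dots,\ell_n\in A$: $\gamma_{\ell_0}=(\exp(\nu_{\ell_0}^u)-1)/\nu_{\ell_0}^v$; $\gamma_{\mathbf{0}^r}=\tau^r/r!$; $\gamma_{\mathbf{0}^r\ell_0}=(\gamma_{\mathbf{0}^r}\exp(\nu_{\ell_0}^u)-\gamma_{\mathbf{0}^{r-1}\ell_0})/\nu_{\ell_0}^v$;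 $\gamma_{\ell_0\ell_1\cdots\ell_n}=(\gamma_{(\ell_0+\ell_1)\ell_2\cdots\ell_n}-\gamma_{\ell_1\cdots\ell_n})/\nu_{\ell_0}^v$; $\gamma_{\mathbf{0}^r\ell_0\ell_1\cdots\ell_n}=(\gamma_{\mathbf{0}^r(\ell_0+\ell_1)\ell_2\cdots\ell_n}-\gamma_{\mathbf{0}^{r-1}\ell_0\ell_1\cdots\ell_n})/\nu_{\ell_0}^v$. *)

theory Defs
  imports "HOL-Analysis.Analysis" "HOL-Library.Function_Algebras"
begin

type_synonym 'n vfield = "complex^'n \<Rightarrow> complex^'n"

(* Smoothness is in the complex sense: the Jacobian matrix has complex entries, so the
   derivative is complex linear, and it can be differentiated again any number of times. *)

primrec times_cdiff :: "nat \<Rightarrow> (complex^'n \<Rightarrow> complex) \<Rightarrow> bool" where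
  "times_cdiff 0 h \<longleftrightarrow> continuous_on UNIV h"
| "times_cdiff (Suc k) h \<longleftrightarrow>
     (\<exists>dh. (\<forall>x. (h has_derivative (\<lambda>y. \<Sum>i\<in>UNIV. dh i x * y $ i)) (at x)) \<and>
           (\<forall>i. times_cdiff k (dh i)))"

definition smooth_vf :: "'n::finite vfield \<Rightarrow> bool" where
  "smooth_vf X \<longleftrightarrow> (\<forall>k i. times_cdiff k (\<lambda>x. X x $ i))"

definition bracket :: "'n::finite vfield \<Rightarrow> 'n vfield \<Rightarrow> 'n vfield" where
  "bracket X Y = (\<lambda>x. jacobian Y (at x) *v X x - jacobian X (at x) *v Y x)"

definition lin_indep_vf :: "('d::finite \<Rightarrow> 'n::finite vfield) \<Rightarrow> bool" where
  "lin_indep_vf G \<longleftrightarrow>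
     (\<forall>c :: 'd \<Rightarrow> complex. (\<forall>x. (\<Sum>j\<in>UNIV. c j *s G j x) = 0) \<longrightarrow> (\<forall>j. c j = 0))"

definition lin_comb :: "('d::finite \<Rightarrow> 'n::finite vfield) \<Rightarrow> complex^'d \<Rightarrow> 'n vfield" where
  "lin_comb G u = (\<lambda>x. \<Sum>j\<in>UNIV. u $ j *s G j x)"

definition nu_lin :: "('d::finite \<Rightarrow> 'a \<Rightarrow> complex) \<Rightarrow> complex^'d \<Rightarrow> 'a \<Rightarrow> complex" where
  "nu_lin \<nu> u l = (\<Sum>j\<in>UNIV. u $ j * \<nu> j l)"

fun word_basis :: "('a \<Rightarrow> 'n::finite vfield) \<Rightarrow> 'a list \<Rightarrow> 'n vfield" where
  "word_basis F [] = (\<lambda>x. x)"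
| "word_basis F [l] = F l"
| "word_basis F (l # m # w) = (\<lambda>x. jacobian (word_basis F (m # w)) (at x) *v F l x)"

(* A formal vector field is a family of vector fields indexed by words; it stands for the sum
   of its terms.  Equality of formal vector fields is equality term by term, and sums are
   formed term by term. *)

type_synonym ('a, 'n) formal_vf = "'a list \<Rightarrow> 'n vfield"

definition word_series :: "('a \<Rightarrow> 'n::finite vfield) \<Rightarrow> ('a list \<Rightarrow> complex) \<Rightarrow> ('a, 'n) formal_vf" where
  "word_series F \<delta> = (\<lambda>w x. \<delta> w *s word_basis F w x)"

(* A vector field that contains none of the letters is placed at the empty word. *)
definition single_vf :: "'n::finite vfield \<Rightarrow> ('a, 'n) formal_vf" where
  "single_vf X = (\<lambda>w. if w = [] then X else 0)"

definition letter_sum :: "('a \<Rightarrow> 'n::finite vfield) \<Rightarrow> ('a, 'n) formal_vf" where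
  "letter_sum F = (\<lambda>w. case w of [l] \<Rightarrow> F l | _ \<Rightarrow> 0)"

(* Expanding the bracket of two formal vector fields gives the terms [X w, Y w'].  The expansion
   is linear in each occurrence of each f_l, so the terms are collected according to the letters
   they contain, counted with multiplicity: the component at M is the coefficient of the monomial
   M when every f_l is multiplied by an indeterminate of its own.  Each component is a finite sum
   by finite_word_pairs. *)

definition formal_bracket ::
  "('a, 'n::finite) formal_vf \<Rightarrow> ('a, 'n) formal_vf \<Rightarrow> 'a multiset \<Rightarrow> 'n vfield" where
  "formal_bracket X Y M =
     (\<lambda>x. \<Sum>(w, w') \<in> {(w, w'). mset w + mset w' = M}. bracket (X w) (Y w') x)"

definition formally_commute :: "('a, 'n::finite) formal_vf \<Rightarrow> ('a, 'n) formal_vf \<Rightarrow> bool" where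
  "formally_commute X Y \<longleftrightarrow> (\<forall>M x. formal_bracket X Y M x = 0)"

lemma finite_word_pairs: "finite {(w, w'). mset w + mset w' = M}"
proof -
  have "{(w, w'). mset w + mset w' = M}
      \<subseteq> {w. set w \<subseteq> set_mset M \<and> length w \<le> size M} \<times> {w. set w \<subseteq> set_mset M \<and> length w \<le> size M}"
    by (auto simp flip: set_mset_mset size_mset)
  then show ?thesis
    by (rule finite_subset) (simp add: finite_lists_length_le)
qed

lemma zeros_cases:
  fixes w :: "'a::zero list"
  obtains (zeros) r where "w = replicate r 0"
  | (nonzero) r l w' where "w = replicate r 0 @ l # w'" "l \<noteq> 0"
proof (induction w arbitrary: thesis)
  case Nil
  then show ?case by (metis replicate_0)
next
  case (Cons a w)
  show ?case
  proof (cases "a = 0")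
    case False
    then show ?thesis using Cons.prems(2)[of 0 a w] by simp
  next
    case True
    show ?thesis
    proof (rule Cons.IH)
      fix r assume "w = replicate r 0"
      then show thesis using True Cons.prems(1)[of "Suc r"] by simp
    next
      fix r l w' assume "w = replicate r 0 @ l # w'" "l \<noteq> 0"
      then show thesis using True Cons.prems(2)[of "Suc r" l w'] by simp
    qed
  qed
qed

lemma zeros_append_eq_iff:
  fixes l l' :: "'a::zero"
  assumes "l \<noteq> 0" "l' \<noteq> 0"
  shows "replicate r 0 @ l # w = replicate r' 0 @ l' # w' \<longleftrightarrow> r = r' \<and> l = l' \<and> w = w'"
proof (induction r arbitrary: r')
  case 0
  then show ?case using assms by (cases r') auto
next
  case (Suc r)
  then show ?case using assms by (cases r') auto
qed

lemma zeros_neq_append: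
  fixes l :: "'a::zero"
  assumes "l \<noteq> 0"
  shows "replicate r 0 \<noteq> replicate r' 0 @ l # w"
proof
  assume "replicate r 0 = replicate r' 0 @ l # w"
  then have "l \<in> set (replicate r 0)" by simp
  then show False using assms by simp
qed

lemmas zeros_simps =
  zeros_append_eq_iff zeros_neq_append zeros_neq_append[THEN not_sym]
  zeros_append_eq_iff[where r = 0, simplified] zeros_append_eq_iff[where r' = 0, simplified]
  zeros_neq_append[where r' = 0, simplified] zeros_neq_append[where r' = 0, simplified, THEN not_sym]

function gam :: "('d::finite \<Rightarrow> 'a::comm_monoid_add \<Rightarrow> complex) \<Rightarrow> complex^'d \<Rightarrow>
    real \<Rightarrow> complex^'d \<Rightarrow> 'a list \<Rightarrow> complex" where
  "gam \<nu> v \<tau> u [] = 1"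
| "r \<ge> 1 \<Longrightarrow> gam \<nu> v \<tau> u (replicate r 0) = of_real \<tau> ^ r / fact r"
| "l0 \<noteq> 0 \<Longrightarrow> gam \<nu> v \<tau> u [l0] = (exp (nu_lin \<nu> u l0) - 1) / nu_lin \<nu> v l0"
| "r \<ge> 1 \<Longrightarrow> l0 \<noteq> 0 \<Longrightarrow> gam \<nu> v \<tau> u (replicate r 0 @ [l0]) =
     (gam \<nu> v \<tau> u (replicate r 0) * exp (nu_lin \<nu> u l0)
       - gam \<nu> v \<tau> u (replicate (r - 1) 0 @ [l0])) / nu_lin \<nu> v l0"
| "l0 \<noteq> 0 \<Longrightarrow> gam \<nu> v \<tau> u (l0 # l1 # w) =
     (gam \<nu> v \<tau> u ((l0 + l1) # w) - gam \<nu> v \<tau> u (l1 # w)) / nu_lin \<nu> v l0"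
| "r \<ge> 1 \<Longrightarrow> l0 \<noteq> 0 \<Longrightarrow> gam \<nu> v \<tau> u (replicate r 0 @ l0 # l1 # w) =
     (gam \<nu> v \<tau> u (replicate r 0 @ (l0 + l1) # w)
       - gam \<nu> v \<tau> u (replicate (r - 1) 0 @ l0 # l1 # w)) / nu_lin \<nu> v l0"
proof goal_cases
  case (1 P a)
  obtain \<nu> v \<tau> u w where a: "a = (\<nu>, v, \<tau>, u, w)" by (metis prod_cases5)
  show P
  proof (cases w rule: zeros_cases)
    case (zeros r)
    then show ?thesis using a 1(1) 1(2)[of r] by (cases "r = 0") auto
  next
    case (nonzero r l w')
    show ?thesis
    proof (cases w')
      case Nil
      then show ?thesis using a nonzero 1(3)[of l] 1(4)[of r l] by (cases "r = 0") auto
    next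
      case (Cons m w'')
      then show ?thesis using a nonzero 1(5)[of l] 1(6)[of r l] by (cases "r = 0") auto
    qed
  qed
qed (auto simp: zeros_simps dest: sym)
termination
  by (relation "Wellfounded.measure (\<lambda>(\<nu>, v, \<tau>, u, w). length w)") auto

(* Hence the derivatives below exist. *)
lemma gam_differentiable:
  fixes a :: "real \<Rightarrow> real" and b :: "real \<Rightarrow> complex^'d"
  assumes a: "(a has_derivative a') (at t)" and b: "(b has_derivative b') (at t)"
  shows "(\<lambda>s. gam \<nu> v (a s) (b s) w) differentiable (at t)"
proof -
  have lin: "(\<lambda>s. nu_lin \<nu> (b s) l) differentiable (at t)" for l
  proof -
    have "((\<lambda>s. nu_lin \<nu> (b s) l) has_derivative (\<lambda>h. \<Sum>j\<in>UNIV. b' h $ j * \<nu> j l)) (at t)"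
      unfolding nu_lin_def
      by (intro has_derivative_sum has_derivative_mult_left bounded_linear.has_derivative[OF _ b]
          bounded_linear_vec_nth)
    then show ?thesis unfolding differentiable_def by blast
  qed
  have ex: "(\<lambda>s. exp (nu_lin \<nu> (b s) l)) differentiable (at t)" for l
  proof -
    obtain D where D: "((\<lambda>s. nu_lin \<nu> (b s) l) has_derivative D) (at t)"
      using lin unfolding differentiable_def by blast
    have "((\<lambda>s. exp (nu_lin \<nu> (b s) l)) has_derivative (\<lambda>h. D h * exp (nu_lin \<nu> (b t) l))) (at t)"
      using has_derivative_compose[OF D DERIV_exp[unfolded has_field_derivative_def]]
      by (simp add: mult.commute)
    then show ?thesis unfolding differentiable_def by blast
  qed
  have pw: "(\<lambda>s. of_real (a s) ^ r / (fact r :: complex)) differentiable (at t)" for r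
  proof -
    have "((\<lambda>s. of_real (a s) :: complex) has_derivative (\<lambda>h. of_real (a' h))) (at t)"
      using a by (intro has_derivative_of_real)
    then have "(\<lambda>s. of_real (a s) :: complex) differentiable (at t)"
      unfolding differentiable_def by blast
    then show ?thesis
      by (simp add: divide_inverse)
  qed
  have quot: "(\<lambda>s. f s / c) differentiable (at t)"
    if "f differentiable (at t)" for f :: "real \<Rightarrow> complex" and c
    using that by (simp add: divide_inverse)
  have "(\<lambda>s. gam \<nu> v (a s) (b s) w) differentiable (at t)"
    for \<tau>0 :: real and u0 :: "complex^'d"
    using lin ex pw
  proof (induction \<nu> v \<tau>0 u0 w rule: gam.induct)
    case (1 \<nu> v \<tau> u)
    then show ?case by simp
  next
    case (2 r \<nu> v \<tau> u)
    then show ?case by (simp only: gam.simps)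
  next
    case (3 l0 \<nu> v \<tau> u)
    show ?case
      unfolding gam.simps(3)[OF 3(1)] by (intro quot differentiable_diff differentiable_const 3)
  next
    case (4 r l0 \<nu> v \<tau> u)
    show ?case
      unfolding gam.simps(4)[OF 4(1,2)]
      by (intro quot differentiable_diff differentiable_mult 4)
  next
    case (5 l0 \<nu> v \<tau> u l1 w)
    show ?case
      unfolding gam.simps(5)[OF 5(1)] by (intro quot differentiable_diff 5)
  next
    case (6 r l0 \<nu> v \<tau> u l1 w)
    show ?case
      unfolding gam.simps(6)[OF 6(1,2)] by (intro quot differentiable_diff 6)
  qed
  then show ?thesis by blast
qed

definition beta_bar ::
  "('d::finite \<Rightarrow> 'a::comm_monoid_add \<Rightarrow> complex) \<Rightarrow> complex^'d \<Rightarrow> 'a list \<Rightarrow> complex" where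
  "beta_bar \<nu> v w = vector_derivative (\<lambda>t. gam \<nu> v t 0 w) (at 0)"

definition rho ::
  "('d::finite \<Rightarrow> 'a::comm_monoid_add \<Rightarrow> complex) \<Rightarrow> complex^'d \<Rightarrow> complex^'d \<Rightarrow> 'a list \<Rightarrow> complex"
where
  "rho \<nu> v u w = vector_derivative (\<lambda>t. gam \<nu> v 0 (t *\<^sub>R u) w) (at 0)"

definition g_tilde ::
  "('d::finite \<Rightarrow> 'n::finite vfield) \<Rightarrow> ('a::comm_monoid_add \<Rightarrow> 'n vfield) \<Rightarrow>
   ('d \<Rightarrow> 'a \<Rightarrow> complex) \<Rightarrow> complex^'d \<Rightarrow> complex^'d \<Rightarrow> ('a, 'n) formal_vf" where
  "g_tilde G F \<nu> v u = single_vf (lin_comb G u) + word_series F (rho \<nu> v u)"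

end

theory Submission
  imports Defs "HOL-Library.Poly_Mapping" "HOL-Computational_Algebra.Polynomial"
begin

text \<open>Why the normal form commutes. The coefficients \<open>gam\<close> are values of universal objects: iterated
integrals of exponentials. In the ring of exponential polynomials \<open>\<Sum> p\<^sub>l(\<tau>) e\<^sub>l\<close>, with \<open>\<tau>\<close> and the
symbols \<open>e\<^sub>l\<close> (\<open>l\<close> in the alphabet, \<open>e\<^sub>l e\<^sub>l\<^sub>' = e\<^sub>l\<^sub>+\<^sub>l\<^sub>'\<close>) treated as independent, the derivation \<open>D\<close> with \<open>D \<tau> = 1\<close>
and \<open>D e\<^sub>l = \<nu>\<^sub>l\<^sup>v e\<^sub>l\<close> has only constants in its kernel, because the vector \<open>v\<close> is nonresonant. So
\<open>D I(w l) = e\<^sub>l I(w)\<close>, together with the vanishing of \<open>I(w l)\<close> at \<open>\<tau> = 0, e = 1\<close>, determines an element \<open>I(w)\<close>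
for every word, and two elements are equal as soon as their images under \<open>D\<close> and under this evaluation are. The
recursion that defines \<open>gam\<close> is an identity between the \<open>I(w)\<close> (\<open>iter_int_zeros_merge\<close>), hence
\<open>gam\<close> at \<open>(\<tau>, u)\<close> is the value of \<open>I(w)\<close> at \<open>\<tau>\<close> and \<open>e\<^sub>l = exp \<nu>\<^sub>l\<^sup>u\<close> (\<open>gam_eq_eval\<close>).

Independence of the \<open>e\<^sub>l\<close> is what allows the arguments \<open>\<tau>\<close> and \<open>u\<close> to vary separately. For each
direction \<open>(c, u)\<close> there is a derivation with \<open>\<tau> \<mapsto> c\<close> and \<open>e\<^sub>l \<mapsto> \<nu>\<^sub>l\<^sup>u e\<^sub>l\<close>; applied to \<open>I(w)\<close> and
evaluated at \<open>\<tau> = 0, e = 1\<close> it gives coefficients \<open>\<lambda>(c, u)\<close>, and \<open>\<lambda>(1, 0)\<close> is \<open>beta_bar\<close>,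
\<open>\<lambda>(0, u)\<close> is \<open>rho u\<close>, while \<open>\<lambda>(1, v)\<close> belongs to \<open>D\<close> itself and is the indicator of the one-letter
words. Linearity of \<open>\<lambda>\<close> in the direction is the decomposition \<open>g + f = g_tilde v + W_beta_bar\<close>. All these
derivations commute, and writing this out on \<open>I(w)\<close> gives the relation \<open>inf_coeff_commutator\<close> between the
convolutions of any two families \<open>\<lambda>\<close>. That relation says exactly that the brackets of the formal fields
\<open>g\<^sup>u + W_\<lambda>(c, u)\<close> vanish (\<open>formally_commute_word_series\<close>), and every field in the theorem has this form.

The last step needs that a bracket of word series is again a word series, with coefficients given by
convolution. This holds for coefficients that vanish on shuffles of nonempty words, a property that
\<open>\<lambda>\<close> inherits from \<open>I(a) I(b) = \<Sum> I(s)\<close>, the sum being over the shuffles of \<open>a\<close> and \<open>b\<close>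
(\<open>iter_int_shuffle\<close>). For such coefficients the Dynkin identity (\<open>Dynkin_primitive\<close>) writes the part of
a word series of given nonempty letter content as a combination of nested brackets of the fields of the letters.
Nested brackets act on functions as first-order operators, so the differential operator \<open>\<Sum> \<lambda>\<^sub>w E\<^sub>w\<close>, with
\<open>E\<^sub>w\<close> the composition of the Lie derivatives along the letters, is the Lie derivative along
\<open>\<Sum> \<lambda>\<^sub>w f\<^sub>w\<close> (\<open>primitive_sum_word_op\<close>).\<close>

section \<open>Coefficients that vanish on shuffles\<close>

text \<open>Sum of \<open>\<phi>\<close> over the shuffles of two words, each given in reverse. The recursion peels letters off the
end of the shuffled word, which is the end at which iterated integrals are differentiated and at which
the expansion of nested brackets below grows; reversing the arguments turns this into a recursion on
heads of lists.\<close>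

fun shuffle_sum :: "('a list \<Rightarrow> 'b::comm_monoid_add) \<Rightarrow> 'a list \<Rightarrow> 'a list \<Rightarrow> 'b" where
  "shuffle_sum \<phi> [] [] = \<phi> []"
| "shuffle_sum \<phi> (x # a) [] = shuffle_sum (\<lambda>s. \<phi> (s @ [x])) a []"
| "shuffle_sum \<phi> [] (y # b) = shuffle_sum (\<lambda>s. \<phi> (s @ [y])) [] b"
| "shuffle_sum \<phi> (x # a) (y # b) =
     shuffle_sum (\<lambda>s. \<phi> (s @ [x])) a (y # b) + shuffle_sum (\<lambda>s. \<phi> (s @ [y])) (x # a) b"

lemma shuffle_sum_Nil_right: "shuffle_sum \<phi> a [] = \<phi> (rev a)"
  by (induction a arbitrary: \<phi>) auto

lemma shuffle_sum_Nil_left: "shuffle_sum \<phi> [] b = \<phi> (rev b)"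
  by (induction b arbitrary: \<phi>) auto

lemma shuffle_sum_additive:
  assumes "\<And>x y. T (x + y) = T x + T y"
  shows "T (shuffle_sum \<phi> a b) = shuffle_sum (\<lambda>s. T (\<phi> s)) a b"
  by (induction \<phi> a b rule: shuffle_sum.induct) (simp_all add: assms)

text \<open>These are the primitive elements of the Hopf algebra dual to the shuffle algebra: words paired with such
coefficients behave as Lie polynomials.\<close>

definition primitive :: "('a list \<Rightarrow> 'b::comm_monoid_add) \<Rightarrow> bool" where
  "primitive \<delta> \<longleftrightarrow> \<delta> [] = 0 \<and> (\<forall>a b. a \<noteq> [] \<longrightarrow> b \<noteq> [] \<longrightarrow> shuffle_sum \<delta> a b = 0)"

text \<open>Moves the letters of \<open>b\<close> one by one across the pivot \<open>l\<close>. The shuffles of \<open>a l\<close> with a word ending in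
\<open>m\<close> end in \<open>l\<close> or in \<open>m\<close>; primitivity makes the two groups cancel, so that making \<open>m\<close> the
pivot costs one sign.\<close>

lemma primitive_shuffle_pivot:
  fixes \<delta> :: "'a list \<Rightarrow> 'b::ring_1"
  assumes "primitive \<delta>"
  shows "shuffle_sum (\<lambda>s. \<delta> (s @ [l])) a b = (-1) ^ length b * \<delta> (rev a @ l # b)"
proof (induction b arbitrary: a l)
  case Nil
  then show ?case by (simp add: shuffle_sum_Nil_right)
next
  case (Cons m b)
  have "shuffle_sum \<delta> (l # a) (m # b) = 0"
    using assms unfolding primitive_def by blast
  then show ?case using Cons[of m "l # a"]
    by (simp add: eq_neg_iff_add_eq_0)
qed

section \<open>The Dynkin identity\<close>

text \<open>The linear extension of \<open>\<phi>\<close> evaluated at the Lie polynomial \<open>[l\<^sub>1, [l\<^sub>2, \<dots> [l\<^sub>n\<^sub>-\<^sub>1, l\<^sub>n]]]\<close>, expanded into words.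
The value at the empty word is a dummy.\<close>

fun nested_bracket :: "('a list \<Rightarrow> 'b::ab_group_add) \<Rightarrow> 'a list \<Rightarrow> 'b" where
  "nested_bracket \<phi> [] = 0"
| "nested_bracket \<phi> [l] = \<phi> [l]"
| "nested_bracket \<phi> (l # m # w) =
     nested_bracket (\<lambda>s. \<phi> (l # s)) (m # w) - nested_bracket (\<lambda>s. \<phi> (s @ [l])) (m # w)"

lemma nested_bracket_Cons:
  "w \<noteq> [] \<Longrightarrow> nested_bracket \<phi> (l # w) =
     nested_bracket (\<lambda>s. \<phi> (l # s)) w - nested_bracket (\<lambda>s. \<phi> (s @ [l])) w"
  by (cases w) auto

lemma nested_bracket_additive:
  assumes "\<And>x y. T (x - y) = T x - T y"
  shows "T (nested_bracket \<phi> w) = nested_bracket (\<lambda>s. T (\<phi> s)) w"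
proof -
  have "T 0 = 0" using assms[of 0 0] by simp
  then show ?thesis
    by (induction \<phi> w rule: nested_bracket.induct) (simp_all add: assms)
qed

definition words :: "'a multiset \<Rightarrow> 'a list set" where
  "words M = {w. mset w = M}"

lemma finite_words: "finite (words M)"
proof -
  have "words M \<subseteq> {w. set w \<subseteq> set_mset M \<and> length w \<le> size M}"
    by (auto simp: words_def)
  then show ?thesis
    by (rule finite_subset) (simp add: finite_lists_length_le)
qed

text \<open>Intermediate stages of expanding \<open>nested_bracket \<phi> w\<close> after \<open>k\<close> steps: \<open>c\<close> is the part of \<open>w\<close> not
yet processed, and each processed letter has been put in front of the inner bracket (collected in
\<open>a\<close>, last one first) or behind it (collected in \<open>b\<close>).\<close>

definition expansion_states :: "'a multiset \<Rightarrow> nat \<Rightarrow> ('a list \<times> 'a list \<times> 'a list) set" where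
  "expansion_states M k = {(a, b, c). mset (a @ b @ c) = M \<and> length a + length b = k}"

lemma finite_expansion_states: "finite (expansion_states M k)"
proof -
  let ?S = "{w. set w \<subseteq> set_mset M \<and> length w \<le> size M}"
  have "expansion_states M k \<subseteq> ?S \<times> ?S \<times> ?S"
    by (auto simp: expansion_states_def simp flip: set_mset_mset size_mset)
  then show ?thesis
    by (rule finite_subset) (simp add: finite_lists_length_le)
qed

text \<open>For fixed \<open>a\<close>, \<open>b\<close>, \<open>c\<close> the words \<open>w\<close> that lead to the state are the shuffles of \<open>rev a\<close> and \<open>rev b\<close>
followed by \<open>c\<close>, which explains the factor \<open>shuffle_sum\<close>. The sum therefore does not depend on \<open>k\<close>; it runs
from \<open>\<Sum> \<delta>\<^sub>w\<close> times nested brackets at \<open>k = 0\<close> to an expression in plain words when one letter is left.\<close>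

definition expansion :: "('a list \<Rightarrow> complex) \<Rightarrow> ('a list \<Rightarrow> complex) \<Rightarrow> 'a multiset \<Rightarrow> nat \<Rightarrow> complex" where
  "expansion \<delta> \<phi> M k = (\<Sum>(a, b, c)\<in>expansion_states M k.
     (-1) ^ length b * shuffle_sum (\<lambda>s. \<delta> (s @ c)) a b * nested_bracket (\<lambda>s. \<phi> (rev a @ s @ b)) c)"

lemma expansion_0: "expansion \<delta> \<phi> M 0 = (\<Sum>w\<in>words M. \<delta> w * nested_bracket \<phi> w)"
  unfolding expansion_def
  by (rule sum.reindex_bij_witness[where i = "\<lambda>c. ([], [], c)" and j = "\<lambda>(a, b, c). c"])
     (auto simp: expansion_states_def words_def)

text \<open>A state at step \<open>k + 1\<close> arises by processing a letter \<open>l\<close> in front or behind, according to which of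
\<open>a\<close>, \<open>b\<close> starts with \<open>l\<close>; on the coefficient side this is the case distinction on the last letter of
the shuffles in \<open>shuffle_sum\<close>.\<close>

lemma expansion_Suc:
  assumes k: "Suc k < size M"
  shows "expansion \<delta> \<phi> M (Suc k) = expansion \<delta> \<phi> M k"
proof -
  define sgn :: "'a list \<Rightarrow> complex" where "sgn b = (-1) ^ length b" for b
  define N where "N a b c = nested_bracket (\<lambda>s. \<phi> (rev a @ s @ b)) c" for a b c
  define L where "L a b l c = shuffle_sum (\<lambda>s. \<delta> (s @ l # c)) a b" for a b l c
  \<comment> \<open>\<open>T1\<close> and \<open>T2\<close> are the contributions to step \<open>k + 1\<close> of the shuffles that end in the head of
    \<open>a\<close> and of \<open>b\<close>; \<open>S1\<close> and \<open>S2\<close> are the two terms of the bracket with the head of \<open>c\<close> at step \<open>k\<close>.\<close>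
  define T1 where "T1 = (\<lambda>(a, b, c). case a of [] \<Rightarrow> 0 | l # a' \<Rightarrow> sgn b * L a' b l c * N a b c)"
  define T2 where "T2 = (\<lambda>(a, b, c). case b of [] \<Rightarrow> 0 | l # b' \<Rightarrow> sgn b * L a b' l c * N a b c)"
  define S1 where "S1 = (\<lambda>(a, b, c). sgn b * L a b (hd c) (tl c) * N (hd c # a) b (tl c))"
  define S2 where "S2 = (\<lambda>(a, b, c). sgn b * L a b (hd c) (tl c) * N a (hd c # b) (tl c))"
  let ?P = "expansion_states M k" and ?Q = "expansion_states M (Suc k)"
  have nonempty: "?P = {(a, b, c). c \<noteq> [] \<and> mset (a @ b @ c) = M \<and> length a + length b = k}"
    using k by (auto simp: expansion_states_def)
  have nonempty': "tl c \<noteq> []" if "(a, b, c) \<in> ?P" for a b c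
    using that k by (cases c) (auto simp: expansion_states_def)
  have "expansion \<delta> \<phi> M (Suc k) = sum (\<lambda>p. T1 p + T2 p) ?Q"
    unfolding expansion_def
  proof (rule sum.cong[OF refl], clarify)
    fix a b c assume "(a, b, c) \<in> ?Q"
    then have "a \<noteq> [] \<or> b \<noteq> []" by (auto simp: expansion_states_def)
    then show "(-1) ^ length b * shuffle_sum (\<lambda>s. \<delta> (s @ c)) a b *
        nested_bracket (\<lambda>s. \<phi> (rev a @ s @ b)) c = T1 (a, b, c) + T2 (a, b, c)"
      by (cases a; cases b) (auto simp: T1_def T2_def sgn_def L_def N_def algebra_simps)
  qed
  also have "\<dots> = sum T1 {p\<in>?Q. fst p \<noteq> []} + sum T2 {p\<in>?Q. fst (snd p) \<noteq> []}"
    unfolding sum.distrib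
    by (intro arg_cong2[where f = "(+)"] sum.mono_neutral_right finite_expansion_states)
       (auto simp: T1_def T2_def)
  also have "sum T1 {p\<in>?Q. fst p \<noteq> []} = sum S1 ?P"
    unfolding nonempty unfolding expansion_states_def
    by (rule sum.reindex_bij_witness[where i = "\<lambda>(a, b, c). (hd c # a, b, tl c)"
          and j = "\<lambda>(a, b, c). (tl a, b, hd a # c)"])
       (auto simp: T1_def S1_def neq_Nil_conv)
  also have "sum T2 {p\<in>?Q. fst (snd p) \<noteq> []} = - sum S2 ?P"
    unfolding nonempty sum_negf[symmetric] unfolding expansion_states_def
    by (rule sum.reindex_bij_witness[where i = "\<lambda>(a, b, c). (a, hd c # b, tl c)"
          and j = "\<lambda>(a, b, c). (a, tl b, hd b # c)"])
       (auto simp: T2_def S2_def sgn_def neq_Nil_conv)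
  also have "sum S1 ?P + - sum S2 ?P = sum (\<lambda>p. S1 p - S2 p) ?P"
    by (simp add: sum_subtractf)
  also have "\<dots> = expansion \<delta> \<phi> M k"
    unfolding expansion_def
  proof (rule sum.cong[OF refl], clarify)
    fix a b c assume "(a, b, c) \<in> ?P"
    then have "c \<noteq> []" "tl c \<noteq> []" using nonempty nonempty' by auto
    then obtain l c' where c: "c = l # c'" "c' \<noteq> []"
      by (cases c) auto
    show "S1 (a, b, c) - S2 (a, b, c) = (-1) ^ length b * shuffle_sum (\<lambda>s. \<delta> (s @ c)) a b *
        nested_bracket (\<lambda>s. \<phi> (rev a @ s @ b)) c"
      by (simp add: S1_def S2_def L_def N_def sgn_def c nested_bracket_Cons algebra_simps)
  qed
  finally show ?thesis .
qed

text \<open>With one letter \<open>l\<close> left, \<open>primitive_shuffle_pivot\<close> reduces the term to \<open>\<delta>\<^sub>w \<phi>\<^sub>w\<close> for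
\<open>w = rev a @ l # b\<close>, with the two signs cancelling. Each word occurs once for every choice of the position of
\<open>l\<close> in it, whence the factor \<open>size M\<close>.\<close>

lemma expansion_last:
  assumes "primitive \<delta>" and M: "size M = Suc k"
  shows "expansion \<delta> \<phi> M k = of_nat (size M) * (\<Sum>w\<in>words M. \<delta> w * \<phi> w)"
proof -
  have states_last: "\<exists>a b l. p = (a, b, [l])" if p: "p \<in> expansion_states M k" for p
  proof -
    obtain a b c where abc: "p = (a, b, c)" "mset (a @ b @ c) = M" "length a + length b = k"
      using p by (auto simp: expansion_states_def)
    have "length (a @ b @ c) = Suc k" using abc(2) M by (metis size_mset)
    then show ?thesis using abc by (auto simp: length_Suc_conv)
  qed
  \<comment> \<open>A state with one letter left is a word with a marked position \<open>i\<close>.\<close>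
  have "expansion \<delta> \<phi> M k = (\<Sum>(w, i)\<in>words M \<times> {..<size M}. \<delta> w * \<phi> w)"
    unfolding expansion_def
  proof (rule sum.reindex_bij_witness[where
      i = "\<lambda>(w, i). (rev (take i w), drop (Suc i) w, [w ! i])" and
      j = "\<lambda>(a, b, c). (rev a @ c @ b, length a)"], goal_cases)
    case (1 p)
    then obtain a b l where "p = (a, b, [l])"
      using M states_last by blast
    then show ?case by (simp add: nth_append)
  next
    case (2 p)
    then show ?case using M
      by (auto simp: expansion_states_def words_def)
  next
    case (3 p)
    then show ?case
      by (auto simp: words_def id_take_nth_drop[symmetric])
  next
    case (4 p)
    then obtain w i where p: "p = (w, i)" "mset w = M" "i < length w"
      by (auto simp: words_def)
    then have "mset (take i w @ w ! i # drop (Suc i) w) = M"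
      by (simp only: id_take_nth_drop[symmetric])
    moreover have "length w = Suc k" using p M by (metis size_mset)
    ultimately show ?case using p by (simp add: expansion_states_def)
  next
    case (5 p)
    then obtain a b l where p: "p = (a, b, [l])"
      using M states_last by blast
    have "(-1) ^ length b * ((-1) ^ length b * \<delta> (rev a @ l # b)) = \<delta> (rev a @ l # b)"
      by (simp flip: mult.assoc power_mult_distrib)
    then show ?case using primitive_shuffle_pivot[OF assms(1), of l a b] p
      by simp
  qed
  then show ?thesis
    by (simp add: sum.cartesian_product[symmetric] sum_distrib_left)
qed

text \<open>The Dynkin-Specht-Wever theorem in dual form: on Lie elements, replacing each word by its nested bracket
multiplies by the degree.\<close>

lemma Dynkin_primitive:
  fixes \<delta> \<phi> :: "'a list \<Rightarrow> complex"
  assumes "primitive \<delta>" and M: "M \<noteq> {#}"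
  shows "(\<Sum>w\<in>words M. \<delta> w * nested_bracket \<phi> w) = of_nat (size M) * (\<Sum>w\<in>words M. \<delta> w * \<phi> w)"
proof -
  obtain n where n: "size M = Suc n" using M by (metis size_eq_0_iff_empty not0_implies_Suc)
  have "expansion \<delta> \<phi> M k = expansion \<delta> \<phi> M 0" if "k \<le> n" for k
    using that by (induction k) (auto simp: expansion_Suc n)
  from this[of n] show ?thesis
    using expansion_last[OF assms(1) n, of \<phi>] by (simp add: expansion_0)
qed

section \<open>The ring of exponential polynomials\<close>

text \<open>The monoid algebra of the alphabet over \<open>\<complex>[\<tau>]\<close>: the term \<open>p\<close> at the letter \<open>l\<close> stands for \<open>p(\<tau>) e\<^sub>l\<close>.
Different letters are kept apart even if their exponents \<open>\<nu>\<^sub>l\<^sup>v\<close> happen to coincide.\<close>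

abbreviation letter_exp :: "'a \<Rightarrow> 'a \<Rightarrow>\<^sub>0 complex poly" where
  "letter_exp l \<equiv> Poly_Mapping.single l 1"

abbreviation const_exp :: "complex \<Rightarrow> 'a::zero \<Rightarrow>\<^sub>0 complex poly" where
  "const_exp c \<equiv> Poly_Mapping.single 0 [:c:]"

lemma exp_poly_induct [case_names single add]:
  assumes single: "\<And>l q. P (Poly_Mapping.single l q)"
    and add: "\<And>x y. P x \<Longrightarrow> P y \<Longrightarrow> P (x + y)"
  shows "P x"
proof (induction x rule: Poly_Mapping.update_induct)
  case const
  show ?case using single[of _ 0] by simp
next
  case (update x l q)
  have "Poly_Mapping.update l q x = x + Poly_Mapping.single l q"
    using update(1)
    by (intro poly_mapping_eqI)
      (auto simp: lookup_update lookup_add lookup_single in_keys_iff when_def)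
  then show ?case using add[OF update(3) single] by simp
qed

text \<open>The derivation with \<open>\<tau> \<mapsto> c\<close> and \<open>e\<^sub>l \<mapsto> m l e\<^sub>l\<close>: differentiation along the flow
\<open>\<tau> + t c\<close>, \<open>exp (t m l) e\<^sub>l\<close>.\<close>

definition exp_deriv :: "complex \<Rightarrow> ('a \<Rightarrow> complex) \<Rightarrow> ('a \<Rightarrow>\<^sub>0 complex poly) \<Rightarrow> 'a \<Rightarrow>\<^sub>0 complex poly" where
  "exp_deriv c m = Poly_Mapping.mapp (\<lambda>l q. smult c (pderiv q) + smult (m l) q)"

lemma lookup_der:
  "Poly_Mapping.lookup (exp_deriv c m x) l =
     smult c (pderiv (Poly_Mapping.lookup x l)) + smult (m l) (Poly_Mapping.lookup x l)"
  by (auto simp: exp_deriv_def lookup_mapp when_def in_keys_iff)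

lemma exp_deriv_add: "exp_deriv c m (x + y) = exp_deriv c m x + exp_deriv c m y"
  by (intro poly_mapping_eqI) (simp add: lookup_der lookup_add pderiv_add smult_add_right)

lemma exp_deriv_minus: "exp_deriv c m (x - y) = exp_deriv c m x - exp_deriv c m y"
  by (intro poly_mapping_eqI) (simp add: lookup_der lookup_minus pderiv_diff smult_diff_right)

lemma exp_deriv_0 [simp]: "exp_deriv c m 0 = 0"
  by (intro poly_mapping_eqI) (simp add: lookup_der)

lemma exp_deriv_sum: "exp_deriv c m (\<Sum>i\<in>I. x i) = (\<Sum>i\<in>I. exp_deriv c m (x i))"
  by (induction I rule: infinite_finite_induct) (simp_all add: exp_deriv_add)

lemma exp_deriv_single:
  "exp_deriv c m (Poly_Mapping.single l q) = Poly_Mapping.single l (smult c (pderiv q) + smult (m l) q)"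
  by (intro poly_mapping_eqI) (auto simp: lookup_der lookup_single when_def)

lemma exp_deriv_commute: "exp_deriv c m (exp_deriv c' m' x) = exp_deriv c' m' (exp_deriv c m x)"
  by (intro poly_mapping_eqI)
    (simp add: lookup_der pderiv_add pderiv_smult smult_add_right algebra_simps)

lemma exp_deriv_mult:
  assumes m: "\<And>l l'. m (l + l') = m l + m l'"
  shows "exp_deriv c m (x * y) = exp_deriv c m x * y + x * exp_deriv c m y"
proof (induction x rule: exp_poly_induct)
  case (single l q)
  show ?case
  proof (induction y rule: exp_poly_induct)
    case (single l' q')
    then show ?case
      by (simp add: mult_single exp_deriv_single m pderiv_mult smult_add_right smult_add_left
          flip: single_add) (simp add: algebra_simps)
  next
    case (add x y)
    then show ?case by (simp add: distrib_left exp_deriv_add algebra_simps)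
  qed
next
  case (add x y)
  then show ?case by (simp add: distrib_right exp_deriv_add algebra_simps)
qed

definition eval_exp :: "complex \<Rightarrow> ('a \<Rightarrow> complex) \<Rightarrow> ('a \<Rightarrow>\<^sub>0 complex poly) \<Rightarrow> complex" where
  "eval_exp c \<kappa> x = (\<Sum>l\<in>Poly_Mapping.keys x. poly (Poly_Mapping.lookup x l) c * \<kappa> l)"

lemma eval_exp_superset:
  assumes "finite K" "Poly_Mapping.keys x \<subseteq> K"
  shows "eval_exp c \<kappa> x = (\<Sum>l\<in>K. poly (Poly_Mapping.lookup x l) c * \<kappa> l)"
  unfolding eval_exp_def
  by (rule sum.mono_neutral_left) (use assms in \<open>auto simp: in_keys_iff\<close>)

lemma eval_exp_add: "eval_exp c \<kappa> (x + y) = eval_exp c \<kappa> x + eval_exp c \<kappa> y"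
proof -
  let ?K = "Poly_Mapping.keys x \<union> Poly_Mapping.keys y"
  have "Poly_Mapping.keys (x + y) \<subseteq> ?K" by (rule Poly_Mapping.keys_add)
  then show ?thesis
    by (simp add: eval_exp_superset[of ?K] lookup_add sum.distrib algebra_simps)
qed

lemma eval_exp_single: "eval_exp c \<kappa> (Poly_Mapping.single l q) = poly q c * \<kappa> l"
  by (subst eval_exp_superset[of "{l}"]) auto

lemma eval_exp_0 [simp]: "eval_exp c \<kappa> 0 = 0"
  by (simp add: eval_exp_def)

lemma eval_exp_one: "eval_exp c \<kappa> 1 = \<kappa> 0"
  using eval_exp_single[of c \<kappa> 0 1] by simp

lemma eval_exp_minus: "eval_exp c \<kappa> (x - y) = eval_exp c \<kappa> x - eval_exp c \<kappa> y"
  by (metis add_diff_cancel_right' diff_add_cancel eval_exp_add)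

lemma eval_exp_sum: "eval_exp c \<kappa> (\<Sum>i\<in>I. x i) = (\<Sum>i\<in>I. eval_exp c \<kappa> (x i))"
  by (induction I rule: infinite_finite_induct) (simp_all add: eval_exp_add)

lemma eval_exp_mult:
  assumes \<kappa>: "\<And>l l'. \<kappa> (l + l') = \<kappa> l * \<kappa> l'"
  shows "eval_exp c \<kappa> (x * y) = eval_exp c \<kappa> x * eval_exp c \<kappa> y"
proof (induction x rule: exp_poly_induct)
  case (single l q)
  show ?case
  proof (induction y rule: exp_poly_induct)
    case (single l' q')
    then show ?case by (simp add: mult_single eval_exp_single \<kappa>)
  next
    case (add x y)
    then show ?case by (simp add: distrib_left eval_exp_add)
  qed
next
  case (add x y)
  then show ?case by (simp add: distrib_right eval_exp_add)
qed

abbreviation augm :: "('a \<Rightarrow>\<^sub>0 complex poly) \<Rightarrow> complex" where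
  "augm \<equiv> eval_exp 0 (\<lambda>_. 1)"

lemma augm_one [simp]: "augm 1 = 1"
  by (simp add: eval_exp_one)

lemma augm_mult: "augm (x * y) = augm x * augm y"
  by (rule eval_exp_mult) simp

text \<open>The one place where derivatives in the analytic sense meet the algebraic derivations.\<close>

lemma has_vector_derivative_eval_exp:
  "((\<lambda>t. eval_exp (of_real t * c) (\<lambda>l. exp (of_real t * m l)) x)
     has_vector_derivative augm (exp_deriv c m x)) (at 0)"
proof (induction x rule: exp_poly_induct)
  case (single l q)
  have "((\<lambda>z. poly q (z * c) * exp (z * m l)) has_field_derivative
      (c * poly (pderiv q) 0 + m l * poly q 0)) (at (of_real 0))"
    by (auto intro!: derivative_eq_intros DERIV_chain2[OF poly_DERIV])
  from has_vector_derivative_real_field[OF this]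
  show ?case by (simp add: eval_exp_single exp_deriv_single)
next
  case (add x y)
  then show ?case by (simp add: eval_exp_add exp_deriv_add has_vector_derivative_add)
qed

text \<open>Enough for monomials: for \<open>c = 0\<close> by an antiderivative, for \<open>c \<noteq> 0\<close> by integration by parts, which lowers the
degree.\<close>

lemma poly_linear_ode: "\<exists>r :: complex poly. pderiv r + smult c r = q"
proof -
  have monom: "\<exists>r. pderiv r + smult c r = monom a n" for a :: complex and n
  proof (cases "c = 0")
    case True
    have "pderiv (monom (a / of_nat (Suc n)) (Suc n)) = monom a n"
      by (simp add: pderiv_monom del: of_nat_Suc)
    then show ?thesis using True by auto
  next
    case False
    show ?thesis
    proof (induction n arbitrary: a)
      case 0
      show ?case
        by (rule exI[of _ "[:a / c:]"]) (simp add: False monom_0)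
    next
      case (Suc n)
      obtain r where r: "pderiv r + smult c r = monom (of_nat (Suc n) * a) n"
        using Suc by blast
      have "pderiv (smult (1 / c) (monom a (Suc n) - r)) + smult c (smult (1 / c) (monom a (Suc n) - r))
          = smult (1 / c) (pderiv (monom a (Suc n)) - (pderiv r + smult c r)) + monom a (Suc n)"
        by (simp add: False pderiv_smult pderiv_diff smult_diff_right smult_add_right)
      also have "\<dots> = monom a (Suc n)"
        unfolding r by (simp add: pderiv_monom)
      finally show ?case by blast
    qed
  qed
  define r where "r i = (SOME r. pderiv r + smult c r = monom (coeff q i) i)" for i
  have r: "pderiv (r i) + smult c (r i) = monom (coeff q i) i" for i
    unfolding r_def using monom by (rule someI_ex)
  have pderiv_sum: "pderiv (sum r I) = (\<Sum>i\<in>I. pderiv (r i))" for I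
    by (induction I rule: infinite_finite_induct) (simp_all add: pderiv_add)
  have smult_sum: "smult c (sum r I) = (\<Sum>i\<in>I. smult c (r i))" for I
    by (induction I rule: infinite_finite_induct) (simp_all add: smult_add_right)
  have "pderiv (\<Sum>i\<le>degree q. r i) + smult c (\<Sum>i\<le>degree q. r i) = q"
    by (simp add: pderiv_sum smult_sum r poly_as_sum_of_monoms flip: sum.distrib)
  then show ?thesis by blast
qed

section \<open>Iterated integrals along a nonresonant direction\<close>

definition word_weight :: "('a \<Rightarrow> complex) \<Rightarrow> 'a list \<Rightarrow> complex" where
  "word_weight m w = sum_list (map m w)"

definition convolution :: "('a list \<Rightarrow> complex) \<Rightarrow> ('a list \<Rightarrow> complex) \<Rightarrow> 'a list \<Rightarrow> complex" where
  "convolution \<delta> \<delta>' w = (\<Sum>i\<le>length w. \<delta> (take i w) * \<delta>' (drop i w))"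

locale nonresonant_weight =
  fixes m :: "'a::comm_monoid_add \<Rightarrow> complex"
  assumes m_add: "m (l + l') = m l + m l'"
    and m_eq_0_iff: "m l = 0 \<longleftrightarrow> l = 0"
begin

lemma m_zero [simp]: "m 0 = 0"
  by (simp add: m_eq_0_iff)

text \<open>On the term at \<open>l \<noteq> 0\<close> the derivation is \<open>p \<mapsto> p' + m l p\<close>, which preserves the leading coefficient up to the
nonzero factor \<open>m l\<close>; on the term at \<open>0\<close> it is ordinary differentiation, which loses only constants. All
identities below for iterated integrals follow by induction on the word from this uniqueness.\<close>

lemma flow_unique:
  assumes D: "exp_deriv 1 m x = exp_deriv 1 m y" and aug: "augm x = augm y"
  shows "x = y"
proof -
  define z where "z = x - y"
  have D0: "exp_deriv 1 m z = 0" and aug0: "augm z = 0"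
    using D aug by (simp_all add: z_def exp_deriv_minus eval_exp_minus)
  have eq: "pderiv (Poly_Mapping.lookup z l) + smult (m l) (Poly_Mapping.lookup z l) = 0" for l
    using lookup_der[of 1 m z l] by (simp add: D0)
  have nz: "Poly_Mapping.lookup z l = 0" if "l \<noteq> 0" for l
  proof (rule ccontr)
    let ?q = "Poly_Mapping.lookup z l"
    assume q: "?q \<noteq> 0"
    have "m l \<noteq> 0" using that by (simp add: m_eq_0_iff)
    moreover have "coeff (pderiv ?q) (degree ?q) = 0"
      by (simp add: coeff_pderiv coeff_eq_0)
    moreover have "coeff (pderiv ?q + smult (m l) ?q) (degree ?q) = 0"
      using eq[of l] by simp
    ultimately show False using q by simp
  qed
  have "pderiv (Poly_Mapping.lookup z 0) = 0" using eq[of 0] by simp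
  then obtain c where c: "Poly_Mapping.lookup z 0 = [:c:]"
    using pderiv_eq_0_iff degree_eq_zeroE by blast
  have z: "z = Poly_Mapping.single 0 [:c:]"
    by (rule poly_mapping_eqI) (auto simp: lookup_single when_def c nz)
  then have "c = 0" using aug0 by (simp add: eval_exp_single)
  then show ?thesis using z by (simp add: z_def)
qed

text \<open>Constants, placed at the letter \<open>0\<close>, are killed by the derivation, so that a solution can be normalised.\<close>

lemma flow_exists: "\<exists>y. exp_deriv 1 m y = x \<and> augm y = 0"
proof -
  have "\<exists>y. exp_deriv 1 m y = x"
  proof (induction x rule: exp_poly_induct)
    case (single l q)
    then show ?case using poly_linear_ode[of "m l" q]
      by (metis exp_deriv_single smult_1_left)
  next
    case (add x y)
    then show ?case by (metis exp_deriv_add)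
  qed
  then obtain y where y: "exp_deriv 1 m y = x" ..
  have "exp_deriv 1 m (y - const_exp (augm y)) = x \<and> augm (y - const_exp (augm y)) = 0"
    by (simp add: exp_deriv_minus y exp_deriv_single eval_exp_minus eval_exp_single)
  then show ?thesis by blast
qed

definition flow_int :: "('a \<Rightarrow>\<^sub>0 complex poly) \<Rightarrow> 'a \<Rightarrow>\<^sub>0 complex poly" where
  "flow_int x = (SOME y. exp_deriv 1 m y = x \<and> augm y = 0)"

lemma exp_deriv_flow_int: "exp_deriv 1 m (flow_int x) = x" and augm_flow_int: "augm (flow_int x) = 0"
  using someI_ex[OF flow_exists[of x]] by (simp_all add: flow_int_def)

text \<open>The iterated integral of \<open>e\<^sub>l\<^sub>1, \<dots>, e\<^sub>l\<^sub>n\<close> with the last letter outermost: the coefficients of the solution of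
\<open>x' = \<Sum> e\<^sub>l f\<^sub>l(x)\<close> expanded in word basis functions.\<close>

definition iter_int :: "'a list \<Rightarrow> 'a \<Rightarrow>\<^sub>0 complex poly" where
  "iter_int w = foldl (\<lambda>x l. flow_int (letter_exp l * x)) 1 w"

lemma iter_int_Nil [simp]: "iter_int [] = 1"
  by (simp add: iter_int_def)

lemma exp_deriv_iter_int_snoc: "exp_deriv 1 m (iter_int (w @ [l])) = letter_exp l * iter_int w"
  by (simp add: iter_int_def exp_deriv_flow_int)

lemma augm_iter_int: "augm (iter_int w) = (if w = [] then 1 else 0)"
proof (cases w rule: rev_cases)
  case Nil
  then show ?thesis by (simp add: eval_exp_single flip: single_one)
next
  case (snoc w l)
  then show ?thesis by (simp add: iter_int_def augm_flow_int)
qed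

lemma exp_deriv_const [simp]: "exp_deriv 1 m (const_exp k) = 0"
  by (simp add: exp_deriv_single)

lemma exp_deriv_one: "n 0 = 0 \<Longrightarrow> exp_deriv c n 1 = 0"
  by (simp add: exp_deriv_single flip: single_one)

lemma exp_deriv_const_mult:
  assumes "\<And>l l'. n (l + l') = n l + n l'"
  shows "exp_deriv a n (const_exp c * x) = const_exp c * exp_deriv a n x"
proof -
  have "n 0 = 0" using assms[of 0 0] by simp
  then show ?thesis by (simp add: exp_deriv_mult[OF assms] exp_deriv_single)
qed

lemma iter_int_zeros: "iter_int (replicate r 0) = Poly_Mapping.single 0 (monom (1 / fact r) r)"
proof (induction r)
  case 0
  then show ?case by (simp add: monom_0 one_pCons[symmetric])
next
  case (Suc r)
  show ?case
  proof (rule flow_unique)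
    have "exp_deriv 1 m (iter_int (replicate (Suc r) 0)) = Poly_Mapping.single 0 (monom (1 / fact r) r)"
      by (simp only: replicate_Suc replicate_append_same[symmetric] exp_deriv_iter_int_snoc Suc) simp
    also have "\<dots> = exp_deriv 1 m (Poly_Mapping.single 0 (monom (1 / fact (Suc r)) (Suc r)))"
      by (simp add: exp_deriv_single pderiv_monom del: of_nat_Suc)
    finally show "exp_deriv 1 m (iter_int (replicate (Suc r) 0)) = \<dots>" .
    show "augm (iter_int (replicate (Suc r) 0)) =
        augm (Poly_Mapping.single 0 (monom (1 / fact (Suc r)) (Suc r)))"
      by (simp only: augm_iter_int) (simp add: eval_exp_single poly_monom)
  qed
qed

lemma augm_const_mult: "augm (const_exp c * x) = c * augm x"
  by (simp add: augm_mult eval_exp_single)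

text \<open>Together with \<open>iter_int_zeros_merge\<close> this is the recursion for \<open>gam\<close>. With \<open>r\<close> leading zeros, the letter
that drops out is the first zero, and \<open>l\<close> itself if \<open>r = 0\<close>; both cases are the tail of the word.
Integrating \<open>e\<^sub>l\<close> by parts is the reason for the identity.\<close>

lemma iter_int_zeros_letter:
  "const_exp (m l) * iter_int (replicate r 0 @ [l]) =
     letter_exp l * iter_int (replicate r 0) - iter_int (tl (replicate r 0 @ [l]))"
proof (rule flow_unique)
  show "exp_deriv 1 m (const_exp (m l) * iter_int (replicate r 0 @ [l])) =
      exp_deriv 1 m (letter_exp l * iter_int (replicate r 0) - iter_int (tl (replicate r 0 @ [l])))"
  proof (cases r)
    case 0
    then show ?thesis
      by (simp add: exp_deriv_const_mult[OF m_add] exp_deriv_minus exp_deriv_mult[OF m_add] exp_deriv_one exp_deriv_single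
          exp_deriv_iter_int_snoc[of "[]", simplified] mult_single)
  next
    case (Suc r')
    have snoc: "replicate r 0 = replicate r' 0 @ [0::'a]"
      by (simp add: Suc replicate_append_same)
    have "exp_deriv 1 m (iter_int (replicate r 0)) = iter_int (replicate r' 0)"
      unfolding snoc exp_deriv_iter_int_snoc by simp
    moreover have "exp_deriv 1 m (iter_int (tl (replicate r 0 @ [l]))) = letter_exp l * iter_int (replicate r' 0)"
      by (simp add: Suc exp_deriv_iter_int_snoc)
    moreover have "exp_deriv 1 m (letter_exp l) = const_exp (m l) * letter_exp l"
      by (simp add: exp_deriv_single mult_single)
    ultimately show ?thesis
      by (simp add: exp_deriv_const_mult[OF m_add] exp_deriv_minus exp_deriv_mult[OF m_add] exp_deriv_iter_int_snoc algebra_simps)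
  qed
  show "augm (const_exp (m l) * iter_int (replicate r 0 @ [l])) =
      augm (letter_exp l * iter_int (replicate r 0) - iter_int (tl (replicate r 0 @ [l])))"
    by (cases r) (simp_all add: augm_const_mult augm_mult eval_exp_minus augm_iter_int eval_exp_single)
qed

text \<open>Integration by parts in the variable of \<open>l\<close>: the boundary term at the upper end multiplies \<open>e\<^sub>l\<close> with the
next exponential \<open>e\<^sub>l\<^sub>'\<close>, which merges the two letters. Letters behind them are carried along by the
induction, since the derivation acts on the last letter only.\<close>

lemma iter_int_zeros_merge:
  "const_exp (m l) * iter_int (replicate r 0 @ l # l' # w) =
     iter_int (replicate r 0 @ (l + l') # w) - iter_int (tl (replicate r 0 @ l # l' # w))"
proof (induction w rule: rev_induct)
  case Nil
  show ?case
  proof (rule flow_unique)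
    have "exp_deriv 1 m (const_exp (m l) * iter_int (replicate r 0 @ [l, l'])) =
        letter_exp l' * (const_exp (m l) * iter_int (replicate r 0 @ [l]))"
      using exp_deriv_iter_int_snoc[of "replicate r 0 @ [l]" l'] by (simp add: exp_deriv_const_mult[OF m_add])
    also have "\<dots> = letter_exp (l + l') * iter_int (replicate r 0) -
        letter_exp l' * iter_int (tl (replicate r 0 @ [l]))"
      by (simp add: iter_int_zeros_letter right_diff_distrib mult_single add.commute flip: mult.assoc)
    also have "\<dots> = exp_deriv 1 m (iter_int (replicate r 0 @ [l + l']) - iter_int (tl (replicate r 0 @ [l]) @ [l']))"
      by (simp only: exp_deriv_minus exp_deriv_iter_int_snoc)
    finally show "exp_deriv 1 m (const_exp (m l) * iter_int (replicate r 0 @ [l, l'])) =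
        exp_deriv 1 m (iter_int (replicate r 0 @ [l + l']) - iter_int (tl (replicate r 0 @ [l, l'])))"
      by (cases r) simp_all
    show "augm (const_exp (m l) * iter_int (replicate r 0 @ [l, l'])) =
        augm (iter_int (replicate r 0 @ [l + l']) - iter_int (tl (replicate r 0 @ [l, l'])))"
      by (cases r) (simp_all add: augm_const_mult eval_exp_minus augm_iter_int)
  qed
next
  case (snoc k w)
  show ?case
  proof (rule flow_unique)
    have "exp_deriv 1 m (const_exp (m l) * iter_int (replicate r 0 @ l # l' # w @ [k])) =
        letter_exp k * (const_exp (m l) * iter_int (replicate r 0 @ l # l' # w))"
      using exp_deriv_iter_int_snoc[of "replicate r 0 @ l # l' # w" k] by (simp add: exp_deriv_const_mult[OF m_add])
    also have "\<dots> = letter_exp k * iter_int (replicate r 0 @ (l + l') # w) -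
        letter_exp k * iter_int (tl (replicate r 0 @ l # l' # w))"
      by (simp add: snoc right_diff_distrib)
    also have "\<dots> = exp_deriv 1 m (iter_int ((replicate r 0 @ (l + l') # w) @ [k]) -
        iter_int (tl (replicate r 0 @ l # l' # w) @ [k]))"
      by (simp only: exp_deriv_minus exp_deriv_iter_int_snoc)
    finally show "exp_deriv 1 m (const_exp (m l) * iter_int (replicate r 0 @ l # l' # w @ [k])) =
        exp_deriv 1 m (iter_int (replicate r 0 @ (l + l') # w @ [k]) -
          iter_int (tl (replicate r 0 @ l # l' # w @ [k])))"
      by (cases r) simp_all
    show "augm (const_exp (m l) * iter_int (replicate r 0 @ l # l' # w @ [k])) =
        augm (iter_int (replicate r 0 @ (l + l') # w @ [k]) -
          iter_int (tl (replicate r 0 @ l # l' # w @ [k])))"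
      by (cases r) (simp_all add: augm_const_mult eval_exp_minus augm_iter_int)
  qed
qed

text \<open>The product rule for iterated integrals: differentiating the product removes the last letter of either
factor, in the same way as the last letter of a shuffle comes from either word.\<close>

lemma iter_int_shuffle: "iter_int (rev a) * iter_int (rev b) = shuffle_sum iter_int a b"
proof -
  have gen: "exp_deriv 1 m (shuffle_sum (\<lambda>s. iter_int (s @ [l])) a b) = letter_exp l * shuffle_sum iter_int a b"
    for l and a b :: "'a list"
    by (simp add: shuffle_sum_additive[where T = "exp_deriv 1 m", OF exp_deriv_add] exp_deriv_iter_int_snoc
      shuffle_sum_additive[where T = "\<lambda>x. letter_exp l * x", OF distrib_left])
  have aug: "augm (shuffle_sum (\<lambda>s. iter_int (s @ [l])) a b) = 0" for l and a b :: "'a list"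
  proof -
    have "shuffle_sum (\<lambda>_. 0 :: complex) a b = 0"
      using shuffle_sum_additive[of "\<lambda>_. 0" "\<lambda>_. 0 :: complex" a b] by simp
    then show ?thesis
      by (simp add: shuffle_sum_additive[where T = augm, OF eval_exp_add] augm_iter_int)
  qed
  show ?thesis
  proof (induction "length a + length b" arbitrary: a b rule: less_induct)
    case less
    show ?case
    proof (cases "a = [] \<or> b = []")
      case True
      then show ?thesis by (auto simp: shuffle_sum_Nil_right shuffle_sum_Nil_left)
    next
      case False
      then obtain x a' y b' where ab: "a = x # a'" "b = y # b'"
        by (meson neq_Nil_conv)
      have 1: "iter_int (rev a') * iter_int (rev b) = shuffle_sum iter_int a' b"
        and 2: "iter_int (rev a) * iter_int (rev b') = shuffle_sum iter_int a b'"
        using less[of a' b] less[of a b'] by (simp_all add: ab)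
      show ?thesis
      proof (rule flow_unique)
        have "exp_deriv 1 m (iter_int (rev a) * iter_int (rev b)) =
            letter_exp x * (iter_int (rev a') * iter_int (rev b)) + letter_exp y * (iter_int (rev a) * iter_int (rev b'))"
          by (simp add: ab exp_deriv_mult[OF m_add] exp_deriv_iter_int_snoc ac_simps)
        also have "\<dots> = exp_deriv 1 m (shuffle_sum iter_int a b)"
          unfolding 1 2 by (simp add: ab exp_deriv_add gen)
        finally show "exp_deriv 1 m (iter_int (rev a) * iter_int (rev b)) = \<dots>" .
        show "augm (iter_int (rev a) * iter_int (rev b)) = augm (shuffle_sum iter_int a b)"
          by (simp add: ab augm_mult augm_iter_int eval_exp_add aug)
      qed
    qed
  qed
qed

section \<open>Infinitesimal coefficients and their commutation relation\<close>

text \<open>The derivative of the iterated integrals at the point \<open>\<tau> = 0, e = 1\<close> in the direction \<open>(c, n)\<close>.\<close>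

definition inf_coeff :: "complex \<Rightarrow> ('a \<Rightarrow> complex) \<Rightarrow> 'a list \<Rightarrow> complex" where
  "inf_coeff c n w = augm (exp_deriv c n (iter_int w))"

text \<open>A derivation at the point \<open>\<tau> = 0, e = 1\<close> kills products of elements vanishing there, and a shuffle sum is
such a product by \<open>iter_int_shuffle\<close>.\<close>

lemma primitive_inf_coeff:
  assumes n: "\<And>l l'. n (l + l') = n l + n l'"
  shows "primitive (inf_coeff c n)"
  unfolding primitive_def
proof (intro conjI allI impI)
  have "n 0 = 0" using n[of 0 0] by simp
  then show "inf_coeff c n [] = 0" by (simp add: inf_coeff_def exp_deriv_one)
next
  fix a b :: "'a list" assume "a \<noteq> []" "b \<noteq> []"
  have "shuffle_sum (inf_coeff c n) a b = augm (exp_deriv c n (shuffle_sum iter_int a b))"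
    using shuffle_sum_additive[of "\<lambda>x. augm (exp_deriv c n x)" iter_int a b]
    by (simp add: exp_deriv_add eval_exp_add inf_coeff_def[abs_def])
  also have "\<dots> = augm (exp_deriv c n (iter_int (rev a) * iter_int (rev b)))"
    by (simp add: iter_int_shuffle)
  also have "\<dots> = 0"
    using \<open>a \<noteq> []\<close> \<open>b \<noteq> []\<close> by (simp add: exp_deriv_mult[OF n] eval_exp_add augm_mult augm_iter_int)
  finally show "shuffle_sum (inf_coeff c n) a b = 0" .
qed

lemma inf_coeff_Nil [simp]:
  assumes n: "\<And>l l'. n (l + l') = n l + n l'"
  shows "inf_coeff c n [] = 0"
  using primitive_inf_coeff[OF n] by (simp add: primitive_def)

text \<open>Infinitesimal form of the composition law of the flow: moving \<open>(\<tau>, e)\<close> in the direction \<open>(c, n)\<close>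
amounts to inserting an infinitesimal piece of path before the given one, which splits the word, and
to rescaling the exponentials of all letters along the given path, which gives the weight. Both sides
have the same image under \<open>exp_deriv 1 m\<close> because the two derivations commute.\<close>

lemma exp_deriv_iter_int:
  assumes n: "\<And>l l'. n (l + l') = n l + n l'"
  shows "exp_deriv c n (iter_int w) =
    (\<Sum>i\<le>length w. const_exp (inf_coeff c n (take i w)) * iter_int (drop i w)) +
      const_exp (word_weight n w) * iter_int w"
proof (induction w rule: rev_induct)
  case Nil
  have "n 0 = 0" using n[of 0 0] by simp
  then show ?case by (simp add: exp_deriv_one inf_coeff_Nil[OF n] word_weight_def)
next
  case (snoc l w)
  let ?S = "\<lambda>w. \<Sum>i\<le>length w. const_exp (inf_coeff c n (take i w)) * iter_int (drop i w)"
  show ?case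
  proof (rule flow_unique)
    have "exp_deriv 1 m (?S (w @ [l])) =
        (\<Sum>i\<le>length w. const_exp (inf_coeff c n (take i w)) * (letter_exp l * iter_int (drop i w)))"
      by (simp add: exp_deriv_add exp_deriv_sum exp_deriv_const_mult[OF m_add] exp_deriv_one exp_deriv_iter_int_snoc)
    also have "\<dots> = letter_exp l * ?S w"
      by (simp add: sum_distrib_left ac_simps)
    finally have S: "exp_deriv 1 m (?S (w @ [l])) = letter_exp l * ?S w" .
    have e: "exp_deriv c n (letter_exp l) = const_exp (n l) * letter_exp l"
      by (simp add: exp_deriv_single mult_single)
    have W: "const_exp (word_weight n (w @ [l])) = const_exp (word_weight n w) + const_exp (n l)"
      by (simp add: word_weight_def flip: single_add)
    have "exp_deriv 1 m (exp_deriv c n (iter_int (w @ [l]))) = exp_deriv c n (letter_exp l * iter_int w)"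
      by (subst exp_deriv_commute) (simp add: exp_deriv_iter_int_snoc)
    also have "\<dots> = const_exp (n l) * letter_exp l * iter_int w + letter_exp l * exp_deriv c n (iter_int w)"
      by (simp add: exp_deriv_mult[OF n] e)
    also have "\<dots> = letter_exp l * ?S w + const_exp (word_weight n (w @ [l])) * (letter_exp l * iter_int w)"
      by (simp only: snoc W) (simp add: algebra_simps)
    also have "\<dots> = exp_deriv 1 m (?S (w @ [l]) + const_exp (word_weight n (w @ [l])) * iter_int (w @ [l]))"
      by (simp only: exp_deriv_add S exp_deriv_const_mult[OF m_add] exp_deriv_iter_int_snoc)
    finally show "exp_deriv 1 m (exp_deriv c n (iter_int (w @ [l]))) = \<dots>" .
    have "augm (?S (w @ [l])) = inf_coeff c n (w @ [l])"
      by (simp add: eval_exp_add eval_exp_sum augm_const_mult augm_iter_int eval_exp_single)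
    then show "augm (exp_deriv c n (iter_int (w @ [l]))) =
        augm (?S (w @ [l]) + const_exp (word_weight n (w @ [l])) * iter_int (w @ [l]))"
      by (simp add: eval_exp_add augm_const_mult augm_iter_int inf_coeff_def)
  qed
qed

text \<open>Apply a second derivation to \<open>exp_deriv_iter_int\<close> and evaluate; the result is symmetric in the two
directions since derivations commute.\<close>

lemma inf_coeff_commutator:
  assumes n: "\<And>l l'. n (l + l') = n l + n l'" and n': "\<And>l l'. n' (l + l') = n' l + n' l'"
  shows "convolution (inf_coeff c n) (inf_coeff c' n') w + word_weight n w * inf_coeff c' n' w =
         convolution (inf_coeff c' n') (inf_coeff c n) w + word_weight n' w * inf_coeff c n w"
proof -
  have *: "augm (exp_deriv c' n' (exp_deriv c n (iter_int w))) =
      convolution (inf_coeff c n) (inf_coeff c' n') w + word_weight n w * inf_coeff c' n' w"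
    if n: "\<And>l l'. n (l + l') = n l + n l'" and n': "\<And>l l'. n' (l + l') = n' l + n' l'" for c c' n n'
    unfolding exp_deriv_iter_int[OF n]
    by (simp add: exp_deriv_add exp_deriv_sum exp_deriv_const_mult[OF n'] eval_exp_add eval_exp_sum
        augm_const_mult convolution_def flip: inf_coeff_def)
  show ?thesis
    using *[OF n n', of c' c] *[OF n' n, of c c'] by (simp add: exp_deriv_commute[of c' n'])
qed

text \<open>In the direction \<open>(1, m)\<close> the derivation strips the last letter of an iterated integral, and what
remains vanishes at \<open>\<tau> = 0, e = 1\<close> unless no letter is left. So the word series attached to this
direction is the perturbation \<open>f\<close> itself.\<close>

lemma inf_coeff_flow: "inf_coeff 1 m w = (if length w = 1 then 1 else 0)"
proof (cases w rule: rev_cases)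
  case Nil
  then show ?thesis by (simp add: inf_coeff_Nil[OF m_add])
next
  case (snoc w' l)
  then show ?thesis
    by (simp add: inf_coeff_def exp_deriv_iter_int_snoc augm_mult augm_iter_int eval_exp_single)
qed

lemma inf_coeff_add: "inf_coeff c n w + inf_coeff c' n' w = inf_coeff (c + c') (\<lambda>l. n l + n' l) w"
proof -
  have "exp_deriv (c + c') (\<lambda>l. n l + n' l) x = exp_deriv c n x + exp_deriv c' n' x" for x :: "'a \<Rightarrow>\<^sub>0 complex poly"
    by (rule poly_mapping_eqI) (simp add: lookup_add lookup_der smult_add_left)
  then show ?thesis by (simp add: inf_coeff_def eval_exp_add)
qed

end

section \<open>The coefficients of the normal form as infinitesimal coefficients\<close>

lemma nu_lin_add:
  assumes "\<And>j l l'. \<nu> j (l + l') = \<nu> j l + \<nu> j l'"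
  shows "nu_lin \<nu> u (l + l') = nu_lin \<nu> u l + nu_lin \<nu> u l'"
  by (simp add: nu_lin_def assms sum.distrib distrib_left)

text \<open>Both sides satisfy the same recursion, evaluation at \<open>\<tau>\<close>, \<open>e\<^sub>l = exp \<nu>\<^sub>l\<^sup>u\<close> being a ring homomorphism.\<close>

lemma gam_eq_eval:
  assumes add: "\<And>j l l'. \<nu> j (l + l') = \<nu> j l + \<nu> j l'"
    and nonres: "\<And>l. nu_lin \<nu> v l = 0 \<longleftrightarrow> l = 0"
  shows "gam \<nu> v \<tau> u w =
    eval_exp (of_real \<tau>) (\<lambda>l. exp (nu_lin \<nu> u l)) (nonresonant_weight.iter_int (nu_lin \<nu> v) w)"
proof -
  interpret nonresonant_weight "nu_lin \<nu> v"
    by unfold_locales (simp_all add: assms nu_lin_add)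
  let ?ev = "eval_exp (of_real \<tau>) (\<lambda>l. exp (nu_lin \<nu> u l))"
  have ev_mult: "?ev (x * y) = ?ev x * ?ev y" for x y
    by (rule eval_exp_mult) (simp add: add nu_lin_add exp_add)
  have "nu_lin \<nu> u 0 = 0" using nu_lin_add[of \<nu> u 0 0] add by simp
  then have ev_one: "?ev 1 = 1" and ev_const: "?ev (const_exp c) = c" for c
    by (simp_all add: eval_exp_one eval_exp_single)
  have ev_letter: "?ev (letter_exp l) = exp (nu_lin \<nu> u l)" for l
    by (simp add: eval_exp_single)
  have ev_divide: "?ev x = (?ev y - ?ev z) / nu_lin \<nu> v l"
    if "const_exp (nu_lin \<nu> v l) * x = y - z" "l \<noteq> 0" for x y z l
  proof -
    have "nu_lin \<nu> v l * ?ev x = ?ev y - ?ev z"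
      using arg_cong[OF that(1), of ?ev] by (simp only: ev_mult ev_const eval_exp_minus)
    then show ?thesis using that(2) nonres[of l] by (simp add: field_simps)
  qed
  show ?thesis
  proof (induction "length w" arbitrary: w rule: less_induct)
    case less
    show ?case
    proof (cases w rule: zeros_cases)
      case (zeros r)
      then show ?thesis using \<open>nu_lin \<nu> u 0 = 0\<close>
        by (cases "r = 0")
          (simp_all only: iter_int_zeros gam.simps(2) eval_exp_single poly_monom, simp_all add: ev_one)
    next
      case (nonzero r l w')
      show ?thesis
      proof (cases w')
        case Nil
        have *: "?ev (iter_int w) = (exp (nu_lin \<nu> u l) * ?ev (iter_int (replicate r 0)) - ?ev (iter_int (tl w))) /
            nu_lin \<nu> v l"
          using ev_divide[OF iter_int_zeros_letter nonzero(2)] nonzero Nil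
          by (simp only: ev_mult ev_letter)
        show ?thesis
        proof (cases r)
          case 0
          then have w: "w = [l]" using nonzero Nil by simp
          show ?thesis using * unfolding w gam.simps(3)[OF nonzero(2)] by (simp add: 0 ev_one)
        next
          case (Suc r')
          then have w: "w = replicate r 0 @ [l]" and tl: "tl w = replicate (r - 1) 0 @ [l]"
            and r: "r \<ge> 1"
            using nonzero Nil by simp_all
          have "gam \<nu> v \<tau> u (replicate r 0) = ?ev (iter_int (replicate r 0))"
            and "gam \<nu> v \<tau> u (replicate (r - 1) 0 @ [l]) = ?ev (iter_int (tl w))"
            unfolding tl by (rule less; use w Suc in simp)+
          then show ?thesis
            using * gam.simps(4)[OF r nonzero(2), of \<nu> v \<tau> u] w by (simp only: mult.commute)
        qed
      next
        case (Cons l' w'')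
        have *: "?ev (iter_int w) = (?ev (iter_int (replicate r 0 @ (l + l') # w'')) - ?ev (iter_int (tl w))) /
            nu_lin \<nu> v l"
          using ev_divide[OF iter_int_zeros_merge nonzero(2)] nonzero Cons by simp
        have merged: "gam \<nu> v \<tau> u (replicate r 0 @ (l + l') # w'') =
            ?ev (iter_int (replicate r 0 @ (l + l') # w''))"
          by (rule less) (simp add: nonzero Cons)
        have tail: "gam \<nu> v \<tau> u (tl w) = ?ev (iter_int (tl w))"
          by (rule less) (simp add: nonzero Cons)
        show ?thesis
        proof (cases r)
          case 0
          then have w: "w = l # l' # w''" and tl: "tl w = l' # w''" using nonzero Cons by simp_all
          show ?thesis
            using * merged tail gam.simps(5)[OF nonzero(2), of \<nu> v \<tau> u l' w''] unfolding tl w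
            by (simp only: 0 replicate_0 append_Nil list.sel)
        next
          case (Suc r')
          then have w: "w = replicate r 0 @ l # l' # w''"
            and tl: "tl w = replicate (r - 1) 0 @ l # l' # w''" and r: "r \<ge> 1"
            using nonzero Cons by simp_all
          show ?thesis
            using * merged tail gam.simps(6)[OF r nonzero(2), of \<nu> v \<tau> u l' w''] unfolding tl
            by (simp only: w)
        qed
      qed
    qed
  qed
qed

lemma
  assumes add: "\<And>j l l'. \<nu> j (l + l') = \<nu> j l + \<nu> j l'"
    and nonres: "\<And>l. nu_lin \<nu> v l = 0 \<longleftrightarrow> l = 0"
  shows beta_bar_eq_inf_coeff: "beta_bar \<nu> v = nonresonant_weight.inf_coeff (nu_lin \<nu> v) 1 (\<lambda>_. 0)"
    and rho_eq_inf_coeff: "rho \<nu> v u = nonresonant_weight.inf_coeff (nu_lin \<nu> v) 0 (nu_lin \<nu> u)"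
proof -
  interpret nonresonant_weight "nu_lin \<nu> v" by unfold_locales (simp_all add: assms nu_lin_add)
  have "beta_bar \<nu> v w = inf_coeff 1 (\<lambda>_. 0) w" for w
    using has_vector_derivative_eval_exp[of 1 "\<lambda>_. 0" "iter_int w"]
    by (auto simp: beta_bar_def gam_eq_eval[OF assms] inf_coeff_def nu_lin_def
        intro!: vector_derivative_at)
  then show "beta_bar \<nu> v = inf_coeff 1 (\<lambda>_. 0)" by blast
  have scale: "nu_lin \<nu> (t *\<^sub>R u) l = of_real t * nu_lin \<nu> u l" for t l
    by (simp add: nu_lin_def scaleR_sum_right flip: scaleR_conv_of_real)
  have "rho \<nu> v u w = inf_coeff 0 (nu_lin \<nu> u) w" for w
    using has_vector_derivative_eval_exp[of 0 "nu_lin \<nu> u" "iter_int w"]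
    by (auto simp: rho_def gam_eq_eval[OF assms] inf_coeff_def scale intro!: vector_derivative_at)
  then show "rho \<nu> v u = inf_coeff 0 (nu_lin \<nu> u)" by blast
qed

section \<open>Partial derivatives of smooth functions\<close>

definition smooth_fn :: "(complex^'n::finite \<Rightarrow> complex) \<Rightarrow> bool" where
  "smooth_fn h \<longleftrightarrow> (\<forall>k. times_cdiff k h)"

definition part_deriv :: "'n::finite \<Rightarrow> (complex^'n \<Rightarrow> complex) \<Rightarrow> complex^'n \<Rightarrow> complex" where
  "part_deriv i h x = frechet_derivative h (at x) (axis i 1)"

lemma part_deriv_eqI: "(h has_derivative h') (at x) \<Longrightarrow> part_deriv i h x = h' (axis i 1)"
  by (simp add: part_deriv_def frechet_derivative_at[symmetric])

lemma times_cdiff_SucD: "times_cdiff (Suc k) h \<Longrightarrow> times_cdiff k h"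
proof (induction k arbitrary: h)
  case 0
  then obtain dh where "\<And>x. (h has_derivative (\<lambda>y. \<Sum>i\<in>UNIV. dh i x * y $ i)) (at x)"
    by auto
  then show ?case
    by (auto intro!: continuous_at_imp_continuous_on has_derivative_continuous)
next
  case (Suc k)
  from Suc.prems obtain dh where
      "\<And>x. (h has_derivative (\<lambda>y. \<Sum>i\<in>UNIV. dh i x * y $ i)) (at x)"
      "\<And>i. times_cdiff (Suc k) (dh i)"
    by (auto simp only: times_cdiff.simps)
  with Suc.IH show ?case unfolding times_cdiff.simps(2)[of k h] by blast
qed

lemma times_cdiff_const: "times_cdiff k (\<lambda>_. c)"
proof (induction k arbitrary: c)
  case (Suc k)
  show ?case unfolding times_cdiff.simps
    by (rule exI[of _ "\<lambda>_ _. 0"]) (simp add: Suc)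
qed simp

lemma times_cdiff_add: "times_cdiff k f \<Longrightarrow> times_cdiff k g \<Longrightarrow> times_cdiff k (\<lambda>x. f x + g x)"
proof (induction k arbitrary: f g)
  case 0
  then show ?case by (simp add: continuous_on_add)
next
  case (Suc k)
  obtain df where df: "\<And>x. (f has_derivative (\<lambda>y. \<Sum>i\<in>UNIV. df i x * y $ i)) (at x)"
      "\<And>i. times_cdiff k (df i)"
    using Suc.prems(1) by auto
  obtain dg where dg: "\<And>x. (g has_derivative (\<lambda>y. \<Sum>i\<in>UNIV. dg i x * y $ i)) (at x)"
      "\<And>i. times_cdiff k (dg i)"
    using Suc.prems(2) by auto
  have "((\<lambda>x. f x + g x) has_derivative (\<lambda>y. \<Sum>i\<in>UNIV. (df i x + dg i x) * y $ i)) (at x)" for x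
    using has_derivative_add[OF df(1) dg(1)] by (simp add: distrib_right sum.distrib)
  moreover have "times_cdiff k (\<lambda>x. df i x + dg i x)" for i
    by (rule Suc.IH[OF df(2) dg(2)])
  ultimately show ?case
    unfolding times_cdiff.simps by (intro exI[of _ "\<lambda>i x. df i x + dg i x"]) blast
qed

lemma times_cdiff_mult: "times_cdiff k f \<Longrightarrow> times_cdiff k g \<Longrightarrow> times_cdiff k (\<lambda>x. f x * g x)"
proof (induction k arbitrary: f g)
  case 0
  then show ?case by (simp add: continuous_on_mult)
next
  case (Suc k)
  obtain df where df: "\<And>x. (f has_derivative (\<lambda>y. \<Sum>i\<in>UNIV. df i x * y $ i)) (at x)"
      "\<And>i. times_cdiff k (df i)"
    using Suc.prems(1) by auto
  obtain dg where dg: "\<And>x. (g has_derivative (\<lambda>y. \<Sum>i\<in>UNIV. dg i x * y $ i)) (at x)"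
      "\<And>i. times_cdiff k (dg i)"
    using Suc.prems(2) by auto
  have "((\<lambda>x. f x * g x) has_derivative
      (\<lambda>y. \<Sum>i\<in>UNIV. (f x * dg i x + df i x * g x) * y $ i)) (at x)" for x
  proof -
    have "(\<lambda>y. \<Sum>i\<in>UNIV. (f x * dg i x + df i x * g x) * y $ i) =
        (\<lambda>y. f x * (\<Sum>i\<in>UNIV. dg i x * y $ i) + (\<Sum>i\<in>UNIV. df i x * y $ i) * g x)"
      by (simp add: fun_eq_iff sum_distrib_left sum.distrib algebra_simps)
    then show ?thesis using has_derivative_mult[OF df(1) dg(1)] by simp
  qed
  moreover have "times_cdiff k (\<lambda>x. f x * dg i x + df i x * g x)" for i
    by (rule times_cdiff_add[OF Suc.IH[OF times_cdiff_SucD[OF Suc.prems(1)] dg(2)]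
          Suc.IH[OF df(2) times_cdiff_SucD[OF Suc.prems(2)]]])
  ultimately show ?case
    unfolding times_cdiff.simps
    by (intro exI[of _ "\<lambda>i x. f x * dg i x + df i x * g x"]) blast
qed

lemma times_cdiff_component: "times_cdiff k (\<lambda>x :: complex^'n::finite. x $ i)"
proof (cases k)
  case 0
  then show ?thesis by (simp add: continuous_on_component continuous_on_id)
next
  case (Suc k')
  have "((\<lambda>x. x $ i) has_derivative (\<lambda>y. \<Sum>j\<in>UNIV. (if j = i then 1 else 0) * y $ j)) (at x)"
    for x :: "complex^'n"
    using bounded_linear.has_derivative[OF bounded_linear_vec_nth has_derivative_ident]
    by (simp add: if_distrib[where f = "\<lambda>c. c * _"] cong: if_cong)
  then show ?thesis unfolding Suc times_cdiff.simps
    by (intro exI[of _ "\<lambda>j _. if j = i then 1 else 0"]) (auto intro: times_cdiff_const)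
qed

lemma smooth_fn_const: "smooth_fn (\<lambda>_. c)"
  and smooth_fn_add: "smooth_fn f \<Longrightarrow> smooth_fn h \<Longrightarrow> smooth_fn (\<lambda>x. f x + h x)"
  and smooth_fn_mult: "smooth_fn f \<Longrightarrow> smooth_fn h \<Longrightarrow> smooth_fn (\<lambda>x. f x * h x)"
  and smooth_fn_component: "smooth_fn (\<lambda>x. x $ i)"
  by (simp_all add: smooth_fn_def times_cdiff_const times_cdiff_add times_cdiff_mult
      times_cdiff_component)

lemma smooth_fn_sum: "(\<And>i. i \<in> I \<Longrightarrow> smooth_fn (f i)) \<Longrightarrow> smooth_fn (\<lambda>x. \<Sum>i\<in>I. f i x)"
  by (induction I rule: infinite_finite_induct) (simp_all add: smooth_fn_const smooth_fn_add)

lemma smooth_fn_has_derivative: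
  assumes "smooth_fn h"
  shows "(h has_derivative (\<lambda>y. \<Sum>i\<in>UNIV. part_deriv i h x * y $ i)) (at x)"
    and smooth_fn_part_deriv: "smooth_fn (part_deriv i h)"
proof -
  have *: "(\<forall>x. (h has_derivative (\<lambda>y. \<Sum>i\<in>UNIV. part_deriv i h x * y $ i)) (at x)) \<and>
      (\<forall>i. times_cdiff k (part_deriv i h))" for k
  proof -
    have "times_cdiff (Suc k) h" using assms by (simp only: smooth_fn_def)
    then obtain dh where dh: "\<And>x. (h has_derivative (\<lambda>y. \<Sum>i\<in>UNIV. dh i x * y $ i)) (at x)"
        "\<And>i. times_cdiff k (dh i)"
      by auto
    have "part_deriv i h x = dh i x" for i x
      by (simp add: part_deriv_eqI[OF dh(1)] axis_def if_distrib[where f = "\<lambda>c. _ * c"] cong: if_cong)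
    then have "part_deriv i h = dh i" for i by blast
    with dh show ?thesis by simp
  qed
  show "(h has_derivative (\<lambda>y. \<Sum>i\<in>UNIV. part_deriv i h x * y $ i)) (at x)" using * by blast
  show "smooth_fn (part_deriv i h)" using * by (simp add: smooth_fn_def)
qed

text \<open>Schwarz's theorem by the classical argument: the second difference over a square of side \<open>h\<close> equals \<open>h\<^sup>2\<close>
times either mixed derivative at some point of the square.\<close>

lemma mixed_derivatives_real:
  fixes f :: "real \<Rightarrow> real \<Rightarrow> real"
  assumes ds: "\<And>s t. ((\<lambda>s. f s t) has_real_derivative ds s t) (at s)"
    and dt: "\<And>s t. ((\<lambda>t. f s t) has_real_derivative dt s t) (at t)"
    and dst: "\<And>s t. ((\<lambda>t. ds s t) has_real_derivative dst s t) (at t)"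
    and dts: "\<And>s t. ((\<lambda>s. dt s t) has_real_derivative dts s t) (at s)"
    and cont: "isCont (\<lambda>(s, t). dst s t) (0, 0)" "isCont (\<lambda>(s, t). dts s t) (0, 0)"
  shows "dst 0 0 = dts 0 0"
proof -
  have mv: "\<exists>\<xi> \<eta>. \<xi> \<in> {0<..<h} \<and> \<eta> \<in> {0<..<h} \<and>
      F h h - F h 0 - (F 0 h - F 0 0) = h * h * Dst \<xi> \<eta>"
    if h: "h > 0"
      and Ds: "\<And>s t. ((\<lambda>s. F s t) has_real_derivative Ds s t) (at s)"
      and Dst: "\<And>s t. ((\<lambda>t. Ds s t) has_real_derivative Dst s t) (at t)"
    for F Ds Dst :: "real \<Rightarrow> real \<Rightarrow> real" and h
  proof -
    obtain \<xi> where \<xi>: "0 < \<xi>" "\<xi> < h"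
      "(F h h - F h 0) - (F 0 h - F 0 0) = (h - 0) * (Ds \<xi> h - Ds \<xi> 0)"
      using MVT2[OF h DERIV_diff[OF Ds Ds], of h 0] by auto
    obtain \<eta> where \<eta>: "0 < \<eta>" "\<eta> < h" "Ds \<xi> h - Ds \<xi> 0 = (h - 0) * Dst \<xi> \<eta>"
      using MVT2[OF h, of "\<lambda>t. Ds \<xi> t" "\<lambda>t. Dst \<xi> t"] Dst by auto
    show ?thesis
      by (rule exI[of _ \<xi>], rule exI[of _ \<eta>]) (use \<xi> \<eta> in auto)
  qed
  have "\<exists>\<xi> \<eta> \<xi>' \<eta>'. \<xi> \<in> {0<..<h} \<and> \<eta> \<in> {0<..<h} \<and> \<xi>' \<in> {0<..<h} \<and> \<eta>' \<in> {0<..<h} \<and>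
      dst \<xi> \<eta> = dts \<xi>' \<eta>'" if h: "h > 0" for h
  proof -
    obtain \<xi> \<eta> where 1: "\<xi> \<in> {0<..<h}" "\<eta> \<in> {0<..<h}"
        "f h h - f h 0 - (f 0 h - f 0 0) = h * h * dst \<xi> \<eta>"
      using mv[OF h ds dst] by blast
    obtain \<eta>' \<xi>' where 2: "\<eta>' \<in> {0<..<h}" "\<xi>' \<in> {0<..<h}"
        "f h h - f 0 h - (f h 0 - f 0 0) = h * h * dts \<xi>' \<eta>'"
      using mv[OF h, of "\<lambda>t s. f s t" "\<lambda>t s. dt s t" "\<lambda>t s. dts s t"] dt dts by blast
    have "h * h * dst \<xi> \<eta> = h * h * dts \<xi>' \<eta>'"
      using 1(3) 2(3) by linarith
    then have "dst \<xi> \<eta> = dts \<xi>' \<eta>'" using h by simp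
    with 1 2 show ?thesis by blast
  qed
  then have "\<forall>n. \<exists>\<xi> \<eta> \<xi>' \<eta>'. \<xi> \<in> {0<..<inverse (real (Suc n))} \<and> \<eta> \<in> {0<..<inverse (real (Suc n))} \<and>
      \<xi>' \<in> {0<..<inverse (real (Suc n))} \<and> \<eta>' \<in> {0<..<inverse (real (Suc n))} \<and>
      dst \<xi> \<eta> = dts \<xi>' \<eta>'"
    by simp
  then obtain \<xi> \<eta> \<xi>' \<eta>' where pts:
      "\<And>n. \<xi> n \<in> {0<..<inverse (real (Suc n))}" "\<And>n. \<eta> n \<in> {0<..<inverse (real (Suc n))}"
      "\<And>n. \<xi>' n \<in> {0<..<inverse (real (Suc n))}" "\<And>n. \<eta>' n \<in> {0<..<inverse (real (Suc n))}"
      and eq: "\<And>n. dst (\<xi> n) (\<eta> n) = dts (\<xi>' n) (\<eta>' n)"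
    by metis
  have to0: "X \<longlonglongrightarrow> 0" if "\<And>n. X n \<in> {0<..<inverse (real (Suc n))}" for X
    by (rule real_tendsto_sandwich[OF _ _ tendsto_const LIMSEQ_inverse_real_of_nat])
      (use that in \<open>auto intro!: always_eventually less_imp_le\<close>)
  have "(\<lambda>n. dst (\<xi> n) (\<eta> n)) \<longlonglongrightarrow> dst 0 0"
    using isCont_tendsto_compose[OF cont(1) tendsto_Pair[OF to0 to0], of \<xi> \<eta>] pts by simp
  moreover have "(\<lambda>n. dts (\<xi>' n) (\<eta>' n)) \<longlonglongrightarrow> dts 0 0"
    using isCont_tendsto_compose[OF cont(2) tendsto_Pair[OF to0 to0], of \<xi>' \<eta>'] pts by simp
  ultimately show ?thesis using eq LIMSEQ_unique by simp
qed

text \<open>Restricts real and imaginary part to the plane through \<open>x\<close> spanned by the two coordinate directions with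
real parameters.\<close>

lemma part_deriv_commute:
  fixes p :: "complex^'n::finite \<Rightarrow> complex"
  assumes p: "smooth_fn p"
  shows "part_deriv i (part_deriv j p) x = part_deriv j (part_deriv i p) x"
proof -
  define pt where "pt s t = x + s *\<^sub>R axis i 1 + t *\<^sub>R axis j 1" for s t
  have line_i: "((\<lambda>s. T (q (pt s t))) has_real_derivative T (part_deriv i q (pt s t))) (at s)"
    and line_j: "((\<lambda>t. T (q (pt s t))) has_real_derivative T (part_deriv j q (pt s t))) (at t)"
    if q: "smooth_fn q" and T: "bounded_linear T" for q s t and T :: "complex \<Rightarrow> real"
  proof -
    have sum_axis: "(\<Sum>l\<in>UNIV. part_deriv l q z * (h *\<^sub>R axis k 1 :: complex^'n) $ l) = h *\<^sub>R part_deriv k q z" for z h k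
      by (simp add: axis_def if_distrib[where f = "\<lambda>c. _ * c"] flip: scaleR_sum_right cong: if_cong)
    have "((\<lambda>s. pt s t) has_derivative (\<lambda>h. h *\<^sub>R axis i 1)) (at s)"
      unfolding pt_def by (auto intro!: derivative_eq_intros)
    from bounded_linear.has_derivative[OF T has_derivative_compose[OF this smooth_fn_has_derivative(1)[OF q]]]
    show "((\<lambda>s. T (q (pt s t))) has_real_derivative T (part_deriv i q (pt s t))) (at s)"
      unfolding sum_axis linear_scale[OF bounded_linear.linear[OF T]]
      by (simp only: has_field_derivative_def mult_commute_abs real_scaleR_def)
    have "((\<lambda>t. pt s t) has_derivative (\<lambda>h. h *\<^sub>R axis j 1)) (at t)"
      unfolding pt_def by (auto intro!: derivative_eq_intros)
    from bounded_linear.has_derivative[OF T has_derivative_compose[OF this smooth_fn_has_derivative(1)[OF q]]]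
    show "((\<lambda>t. T (q (pt s t))) has_real_derivative T (part_deriv j q (pt s t))) (at t)"
      unfolding sum_axis linear_scale[OF bounded_linear.linear[OF T]]
      by (simp only: has_field_derivative_def mult_commute_abs real_scaleR_def)
  qed
  have cont: "isCont (\<lambda>(s, t). T (q (pt s t))) (0, 0)"
    if q: "smooth_fn q" and T: "bounded_linear T" for q and T :: "complex \<Rightarrow> real"
  proof -
    have "continuous_on UNIV q"
      using q times_cdiff.simps(1) unfolding smooth_fn_def by blast
    moreover have "continuous_on UNIV (\<lambda>z :: real \<times> real. pt (fst z) (snd z))"
      unfolding pt_def by (intro continuous_intros)
    ultimately have "continuous_on UNIV (\<lambda>z. T (q (pt (fst z) (snd z))))"
      by (intro bounded_linear.continuous_on[OF T]) (rule continuous_on_compose2, auto)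
    then show ?thesis
      by (simp add: case_prod_unfold continuous_on_eq_continuous_at)
  qed
  have T: "T (part_deriv i (part_deriv j p) x) = T (part_deriv j (part_deriv i p) x)"
    if T: "bounded_linear T" for T :: "complex \<Rightarrow> real"
    using mixed_derivatives_real[where f = "\<lambda>s t. T (p (pt s t))",
        OF line_i[OF p T] line_j[OF p T] line_j[OF smooth_fn_part_deriv[OF p] T]
          line_i[OF smooth_fn_part_deriv[OF p] T]
          cont[OF smooth_fn_part_deriv[OF smooth_fn_part_deriv[OF p]] T]
          cont[OF smooth_fn_part_deriv[OF smooth_fn_part_deriv[OF p]] T]]
    by (simp add: pt_def)
  show ?thesis
    using T[OF bounded_linear_Re] T[OF bounded_linear_Im] by (simp add: complex_eq_iff)
qed

section \<open>Lie derivatives\<close>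

lemma smooth_vf_iff: "smooth_vf X \<longleftrightarrow> (\<forall>i. smooth_fn (\<lambda>x. X x $ i))"
  by (auto simp: smooth_vf_def smooth_fn_def)

lemma smooth_vf_has_derivative:
  fixes X :: "'n::finite vfield"
  assumes "smooth_vf X"
  shows "(X has_derivative (\<lambda>y. \<chi> i. \<Sum>j\<in>UNIV. part_deriv j (\<lambda>x. X x $ i) x * y $ j)) (at x)"
proof -
  have "((\<lambda>x. X x $ i) has_derivative (\<lambda>y. \<Sum>j\<in>UNIV. part_deriv j (\<lambda>x. X x $ i) x * y $ j)) (at x)" for i
    using assms smooth_fn_has_derivative(1) by (auto simp: smooth_vf_iff)
  then show ?thesis
    by (subst has_derivative_componentwise_within)
      (auto simp: Basis_vec_def inner_axis intro!: has_derivative_inner_left)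
qed

lemma jacobian_eq_part_deriv:
  "smooth_vf X \<Longrightarrow> jacobian X (at x) = (\<chi> i j. part_deriv j (\<lambda>x. X x $ i) x)"
  by (simp add: jacobian_def frechet_derivative_at[OF smooth_vf_has_derivative, symmetric]
      matrix_def vec_eq_iff axis_def if_distrib[where f = "\<lambda>c. _ * c"] cong: if_cong)

text \<open>The derivative along \<open>X\<close> of a vector-valued function. Brackets are its antisymmetrisation, and the word
basis functions arise by iterating it on the identity.\<close>

definition lie_der :: "'n::finite vfield \<Rightarrow> 'n vfield \<Rightarrow> 'n vfield" where
  "lie_der X h = (\<lambda>x. jacobian h (at x) *v X x)"

lemma bracket_eq_lie_der: "bracket X Y = lie_der X Y - lie_der Y X"
  by (auto simp: bracket_def lie_der_def fun_eq_iff)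

lemma lie_der_component:
  "smooth_vf h \<Longrightarrow> lie_der X h x $ i = (\<Sum>j\<in>UNIV. part_deriv j (\<lambda>x. h x $ i) x * X x $ j)"
  by (simp add: lie_der_def jacobian_eq_part_deriv matrix_vector_mult_def)

lemma smooth_vf_add: "smooth_vf X \<Longrightarrow> smooth_vf Y \<Longrightarrow> smooth_vf (X + Y)"
  by (simp add: smooth_vf_iff smooth_fn_add)

lemma smooth_vf_scale: "smooth_vf X \<Longrightarrow> smooth_vf (\<lambda>x. c *s X x)"
  by (simp add: smooth_vf_iff smooth_fn_mult smooth_fn_const)

lemma smooth_vf_sum: "(\<And>i. i \<in> I \<Longrightarrow> smooth_vf (X i)) \<Longrightarrow> smooth_vf (\<lambda>x. \<Sum>i\<in>I. X i x)"
  by (auto simp: smooth_vf_iff intro!: smooth_fn_sum)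

lemma smooth_vf_id: "smooth_vf (\<lambda>x. x)"
  by (simp add: smooth_vf_iff smooth_fn_component)

lemma smooth_vf_diff: "smooth_vf X \<Longrightarrow> smooth_vf Y \<Longrightarrow> smooth_vf (X - Y)"
  using smooth_vf_add[OF _ smooth_vf_scale[of Y "-1"], of X]
  by (simp add: plus_fun_def fun_diff_def)

lemma smooth_vf_lie_der:
  assumes "smooth_vf X" "smooth_vf h"
  shows "smooth_vf (lie_der X h)"
  using assms by (auto simp: smooth_vf_iff lie_der_component[OF assms(2)]
      intro!: smooth_fn_sum smooth_fn_mult smooth_fn_part_deriv)

lemma smooth_vf_bracket: "smooth_vf X \<Longrightarrow> smooth_vf Y \<Longrightarrow> smooth_vf (bracket X Y)"
  by (simp add: bracket_eq_lie_der smooth_vf_diff smooth_vf_lie_der)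

lemma part_deriv_sum:
  assumes "\<And>i. i \<in> I \<Longrightarrow> smooth_fn (f i)"
  shows "part_deriv j (\<lambda>x. \<Sum>i\<in>I. f i x) x = (\<Sum>i\<in>I. part_deriv j (f i) x)"
proof -
  have "((\<lambda>x. \<Sum>i\<in>I. f i x) has_derivative (\<lambda>y. \<Sum>i\<in>I. \<Sum>l\<in>UNIV. part_deriv l (f i) x * y $ l)) (at x)"
    by (intro has_derivative_sum smooth_fn_has_derivative(1) assms)
  from part_deriv_eqI[OF this] show ?thesis
    by (simp add: axis_def if_distrib[where f = "\<lambda>c. _ * c"] cong: if_cong)
qed

lemma part_deriv_mult:
  assumes "smooth_fn f" "smooth_fn h"
  shows "part_deriv j (\<lambda>x. f x * h x) x = f x * part_deriv j h x + part_deriv j f x * h x"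
  using part_deriv_eqI[OF has_derivative_mult[OF assms[THEN smooth_fn_has_derivative(1)]], of j]
  by (simp add: axis_def if_distrib[where f = "\<lambda>c. _ * c"] cong: if_cong)

lemma part_deriv_const: "part_deriv j (\<lambda>_. c) x = 0"
  using part_deriv_eqI[OF has_derivative_const[of c "at x"], of j] by simp

text \<open>The second-order terms of the two compositions agree because mixed partial derivatives do.\<close>

lemma lie_der_commutator:
  assumes X: "smooth_vf X" and Y: "smooth_vf Y" and h: "smooth_vf h"
  shows "lie_der X (lie_der Y h) - lie_der Y (lie_der X h) = lie_der (bracket X Y) h"
proof (rule ext)
  fix x
  have expand: "lie_der A (lie_der B h) x $ i =
      (\<Sum>j\<in>UNIV. \<Sum>k\<in>UNIV. part_deriv j (part_deriv k (\<lambda>x. h x $ i)) x * A x $ j * B x $ k) +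
      (\<Sum>k\<in>UNIV. part_deriv k (\<lambda>x. h x $ i) x * lie_der A B x $ k)"
    if A: "smooth_vf A" and B: "smooth_vf B" for A B i
  proof -
    have sm: "smooth_fn (\<lambda>x. B x $ k)" "smooth_fn (part_deriv k (\<lambda>x. h x $ i))" for k
      using B h by (auto simp: smooth_vf_iff intro: smooth_fn_part_deriv)
    have "lie_der A (lie_der B h) x $ i =
        (\<Sum>j\<in>UNIV. part_deriv j (\<lambda>x. \<Sum>k\<in>UNIV. part_deriv k (\<lambda>x. h x $ i) x * B x $ k) x * A x $ j)"
      by (simp add: lie_der_component smooth_vf_lie_der h B)
    also have "\<dots> = (\<Sum>j\<in>UNIV. \<Sum>k\<in>UNIV. part_deriv j (part_deriv k (\<lambda>x. h x $ i)) x * A x $ j * B x $ k +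
        part_deriv k (\<lambda>x. h x $ i) x * (part_deriv j (\<lambda>x. B x $ k) x * A x $ j))"
      by (simp add: part_deriv_sum part_deriv_mult smooth_fn_mult sm sum_distrib_left sum_distrib_right algebra_simps)
    also have "\<dots> = (\<Sum>j\<in>UNIV. \<Sum>k\<in>UNIV. part_deriv j (part_deriv k (\<lambda>x. h x $ i)) x * A x $ j * B x $ k) +
        (\<Sum>k\<in>UNIV. \<Sum>j\<in>UNIV. part_deriv k (\<lambda>x. h x $ i) x * (part_deriv j (\<lambda>x. B x $ k) x * A x $ j))"
      by (simp add: sum.distrib) (rule sum.swap)
    finally show ?thesis
      by (simp add: lie_der_component[OF B] sum_distrib_left)
  qed
  have "(lie_der X (lie_der Y h) x - lie_der Y (lie_der X h) x) $ i = lie_der (bracket X Y) h x $ i" for i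
  proof -
    have sm: "smooth_fn (\<lambda>x. h x $ i)" using h by (simp add: smooth_vf_iff)
    have "(\<Sum>j\<in>UNIV. \<Sum>k\<in>UNIV. part_deriv j (part_deriv k (\<lambda>x. h x $ i)) x * X x $ j * Y x $ k) =
        (\<Sum>j\<in>UNIV. \<Sum>k\<in>UNIV. part_deriv j (part_deriv k (\<lambda>x. h x $ i)) x * Y x $ j * X x $ k)"
      by (subst sum.swap) (simp add: part_deriv_commute[OF sm, of _ _ x] ac_simps)
    then show ?thesis
      by (simp add: expand[OF X Y] expand[OF Y X] lie_der_component[OF h] bracket_eq_lie_der
          right_diff_distrib sum_subtractf)
  qed
  then show "(lie_der X (lie_der Y h) - lie_der Y (lie_der X h)) x = lie_der (bracket X Y) h x"
    by (simp add: vec_eq_iff)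
qed

lemma lie_der_diff:
  assumes "smooth_vf h" "smooth_vf k"
  shows "lie_der X (h - k) = lie_der X h - lie_der X k"
proof (rule ext)
  fix x
  have "part_deriv j (\<lambda>x. h x $ i - k x $ i) x = part_deriv j (\<lambda>x. h x $ i) x - part_deriv j (\<lambda>x. k x $ i) x" for i j
    using part_deriv_eqI[OF has_derivative_diff[OF smooth_fn_has_derivative(1) smooth_fn_has_derivative(1)],
        of "\<lambda>x. h x $ i" "\<lambda>x. k x $ i" j x] assms
    by (simp add: smooth_vf_iff axis_def if_distrib[where f = "\<lambda>c. _ * c"] cong: if_cong)
  then show "lie_der X (h - k) x = (lie_der X h - lie_der X k) x"
    by (simp add: vec_eq_iff lie_der_component smooth_vf_diff assms left_diff_distrib sum_subtractf)
qed

lemma lie_der_sum_right: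
  assumes "\<And>i. i \<in> I \<Longrightarrow> smooth_vf (h i)"
  shows "lie_der X (\<lambda>x. \<Sum>i\<in>I. c i *s h i x) x = (\<Sum>i\<in>I. c i *s lie_der X (h i) x)"
proof -
  have sm: "smooth_vf (\<lambda>x. \<Sum>i\<in>I. c i *s h i x)"
    by (intro smooth_vf_sum smooth_vf_scale assms)
  have "part_deriv j (\<lambda>x. \<Sum>i\<in>I. c i * h i x $ l) x = (\<Sum>i\<in>I. c i * part_deriv j (\<lambda>x. h i x $ l) x)" for j l
  proof -
    have "smooth_fn (\<lambda>x. h i x $ l)" if "i \<in> I" for i
      using assms[OF that] by (simp add: smooth_vf_iff)
    then show ?thesis
      by (simp add: part_deriv_sum part_deriv_mult part_deriv_const smooth_fn_mult smooth_fn_const)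
  qed
  then have "lie_der X (\<lambda>x. \<Sum>i\<in>I. c i *s h i x) x $ l = (\<Sum>i\<in>I. c i *s lie_der X (h i) x) $ l" for l
  proof -
    have "(\<Sum>i\<in>I. c i *s lie_der X (h i) x) $ l =
        (\<Sum>i\<in>I. c i * (\<Sum>j\<in>UNIV. part_deriv j (\<lambda>x. h i x $ l) x * X x $ j))"
      by (simp add: lie_der_component assms)
    also have "\<dots> = (\<Sum>j\<in>UNIV. \<Sum>i\<in>I. c i * part_deriv j (\<lambda>x. h i x $ l) x * X x $ j)"
      by (subst sum.swap) (simp add: sum_distrib_left mult.assoc)
    finally show ?thesis
      using \<open>\<And>l j. part_deriv j (\<lambda>x. \<Sum>i\<in>I. c i * h i x $ l) x = (\<Sum>i\<in>I. c i * part_deriv j (\<lambda>x. h i x $ l) x)\<close>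
      by (simp add: lie_der_component[OF sm] sum_distrib_right)
  qed
  then show ?thesis by (simp add: vec_eq_iff)
qed

lemma lie_der_sum_left:
  "lie_der (\<lambda>x. \<Sum>i\<in>I. c i *s X i x) h x = (\<Sum>i\<in>I. c i *s lie_der (X i) h x)"
  unfolding lie_der_def
  by (induction I rule: infinite_finite_induct)
    (simp_all add: matrix_vector_right_distrib vector_scalar_commute)

section \<open>Word series with primitive coefficients as vector fields\<close>

text \<open>The differential operator of a word, first letter outermost; applied to the identity it gives the word basis
function.\<close>

primrec word_op :: "('a \<Rightarrow> 'n::finite vfield) \<Rightarrow> 'a list \<Rightarrow> 'n vfield \<Rightarrow> 'n vfield" where
  "word_op F [] h = h"
| "word_op F (l # w) h = lie_der (F l) (word_op F w h)"

lemma word_op_append: "word_op F (w @ w') h = word_op F w (word_op F w' h)"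
  by (induction w) simp_all

lemma smooth_word_op:
  "(\<And>l. smooth_vf (F l)) \<Longrightarrow> smooth_vf h \<Longrightarrow> smooth_vf (word_op F w h)"
  by (induction w) (simp_all add: smooth_vf_lie_der)

lemma lie_der_id: "lie_der X (\<lambda>x. x) = X" for X :: "'n::finite vfield"
proof -
  have "frechet_derivative (\<lambda>x :: complex^'n. x) (at x) = (\<lambda>y. y)" for x
    using frechet_derivative_at[OF has_derivative_ident] by metis
  then have "jacobian (\<lambda>x :: complex^'n. x) (at x) = mat 1" for x
    by (simp add: jacobian_def matrix_def mat_def axis_def vec_eq_iff)
  then show ?thesis by (simp add: lie_der_def fun_eq_iff)
qed

lemma word_basis_eq_word_op: "word_basis F w = word_op F w (\<lambda>x. x)"
  by (induction F w rule: word_basis.induct) (simp_all add: lie_der_id, simp add: lie_der_def)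

lemma smooth_word_basis: "(\<And>l. smooth_vf (F l)) \<Longrightarrow> smooth_vf (word_basis F w)"
  by (simp add: word_basis_eq_word_op smooth_word_op smooth_vf_id)

fun word_bracket :: "('a \<Rightarrow> 'n::finite vfield) \<Rightarrow> 'a list \<Rightarrow> 'n vfield" where
  "word_bracket F [] = 0"
| "word_bracket F [l] = F l"
| "word_bracket F (l # m # w) = bracket (F l) (word_bracket F (m # w))"

lemma smooth_vf_zero: "smooth_vf 0"
  by (simp add: smooth_vf_iff smooth_fn_const)

lemma lie_der_zero: "lie_der X 0 = 0"
  using lie_der_diff[OF smooth_vf_zero smooth_vf_zero, of X] by (simp only: diff_self)

lemma smooth_word_bracket: "(\<And>l. smooth_vf (F l)) \<Longrightarrow> smooth_vf (word_bracket F w)"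
  by (induction F w rule: word_bracket.induct) (simp_all add: smooth_vf_zero smooth_vf_bracket)

lemma smooth_nested_bracket:
  fixes \<phi> :: "'a list \<Rightarrow> 'n::finite vfield"
  shows "(\<And>s. smooth_vf (\<phi> s)) \<Longrightarrow> smooth_vf (nested_bracket \<phi> w)"
  by (induction \<phi> w rule: nested_bracket.induct) (simp_all add: smooth_vf_zero smooth_vf_diff)

lemma lie_der_nested_bracket:
  fixes \<phi> :: "'a list \<Rightarrow> 'n::finite vfield"
  assumes "\<And>s. smooth_vf (\<phi> s)"
  shows "lie_der X (nested_bracket \<phi> w) = nested_bracket (\<lambda>s. lie_der X (\<phi> s)) w"
  using assms
proof (induction \<phi> w rule: nested_bracket.induct)
  case (1 \<phi>)
  show ?case by (simp only: nested_bracket.simps lie_der_zero)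
next
  case (3 \<phi> l m w)
  then show ?case by (simp only: nested_bracket.simps lie_der_diff smooth_nested_bracket)
qed simp

text \<open>The operator of a nested bracket is the nested commutator of the operators of its letters. It is first
order as a Lie derivative, while the single words in its expansion are operators of higher order.\<close>

lemma lie_der_word_bracket:
  assumes F: "\<And>l. smooth_vf (F l)" and "w \<noteq> []" "smooth_vf h"
  shows "lie_der (word_bracket F w) h = nested_bracket (\<lambda>s. word_op F s h) w"
  using assms(2,3)
proof (induction w arbitrary: h rule: list_nonempty_induct)
  case (single l)
  then show ?case by simp
next
  case (cons l w)
  have "word_bracket F (l # w) = bracket (F l) (word_bracket F w)"
    using cons(1) by (cases w) simp_all
  then have "lie_der (word_bracket F (l # w)) h =
      lie_der (F l) (lie_der (word_bracket F w) h) - lie_der (word_bracket F w) (lie_der (F l) h)"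
    using lie_der_commutator[OF F smooth_word_bracket[of F w, OF F] cons.prems, of l] by simp
  also have "\<dots> = nested_bracket (\<lambda>s. word_op F (l # s) h) w - nested_bracket (\<lambda>s. word_op F (s @ [l]) h) w"
    using cons.IH[OF cons.prems] cons.IH[OF smooth_vf_lie_der[OF F cons.prems]]
    by (simp add: lie_der_nested_bracket smooth_word_op F cons.prems word_op_append)
  finally show ?case using cons(1) by (simp add: nested_bracket_Cons)
qed

text \<open>By the Dynkin identity both sides are, up to the factor \<open>size M\<close>, the combination of nested brackets
with coefficients \<open>\<delta>\<close>: the left side as an operator applied to \<open>h\<close>, and the vector field on the right side
by the case in which \<open>h\<close> is the identity.\<close>

lemma primitive_sum_word_op:
  assumes F: "\<And>l. smooth_vf (F l)" and prim: "primitive \<delta>" and M: "M \<noteq> {#}" and h: "smooth_vf h"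
  shows "(\<Sum>w\<in>words M. \<delta> w *s word_op F w h x) =
    lie_der (\<lambda>x. \<Sum>w\<in>words M. \<delta> w *s word_basis F w x) h x"
proof -
  let ?n = "of_nat (size M) :: complex"
  have n: "?n \<noteq> 0" using M by simp
  have key: "(\<Sum>w\<in>words M. \<delta> w *s lie_der (word_bracket F w) k x) =
      ?n *s (\<Sum>w\<in>words M. \<delta> w *s word_op F w k x)" if k: "smooth_vf k" for k x
  proof -
    have "(\<Sum>w\<in>words M. \<delta> w * lie_der (word_bracket F w) k x $ i) =
        ?n * (\<Sum>w\<in>words M. \<delta> w * word_op F w k x $ i)" for i
    proof -
      have "lie_der (word_bracket F w) k x $ i = nested_bracket (\<lambda>s. word_op F s k x $ i) w"
        if "w \<in> words M" for w
      proof -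
        have "w \<noteq> []" using that M by (auto simp: words_def)
        then show ?thesis
          using nested_bracket_additive[of "\<lambda>X. X x $ i" "\<lambda>s. word_op F s k" w]
          by (simp add: lie_der_word_bracket F k)
      qed
      then show ?thesis
        using Dynkin_primitive[OF prim M, of "\<lambda>s. word_op F s k x $ i"] by simp
    qed
    then show ?thesis by (simp add: vec_eq_iff)
  qed
  have B: "(\<Sum>w\<in>words M. \<delta> w *s word_bracket F w x) =
      ?n *s (\<Sum>w\<in>words M. \<delta> w *s word_basis F w x)" for x
    using key[OF smooth_vf_id] by (simp add: lie_der_id word_basis_eq_word_op)
  have "?n *s (\<Sum>w\<in>words M. \<delta> w *s word_op F w h x) =
      lie_der (\<lambda>x. \<Sum>w\<in>words M. \<delta> w *s word_bracket F w x) h x"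
    by (simp add: lie_der_sum_left key h)
  also have "\<dots> = ?n *s lie_der (\<lambda>x. \<Sum>w\<in>words M. \<delta> w *s word_basis F w x) h x"
    unfolding B by (simp add: lie_der_def vector_scalar_commute)
  finally show ?thesis using n by (simp add: vec_eq_iff)
qed

text \<open>Commuting the derivative along \<open>Y\<close> past the letters one after the other collects their eigenvalues.\<close>

lemma lie_der_word_op_eigen:
  assumes F: "\<And>l. smooth_vf (F l)" and Y: "smooth_vf Y" and h: "smooth_vf h"
    and eigen: "\<And>l x. bracket Y (F l) x = n l *s F l x"
  shows "lie_der Y (word_op F w h) x = word_op F w (lie_der Y h) x + word_weight n w *s word_op F w h x"
proof (induction w arbitrary: x)
  case Nil
  then show ?case by (simp add: word_weight_def)
next
  case (Cons l w)
  have sm: "smooth_vf (word_op F w h)" "smooth_vf (word_op F w (lie_der Y h))"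
    by (simp_all add: smooth_word_op F h Y smooth_vf_lie_der)
  \<comment> \<open>Written as a sum over the truth values, to which \<open>lie_der_sum_right\<close> applies.\<close>
  have eq: "lie_der Y (word_op F w h) = (\<lambda>x. \<Sum>b\<in>UNIV. (if b then 1 else word_weight n w) *s
      (if b then word_op F w (lie_der Y h) else word_op F w h) x)"
    by (simp add: fun_eq_iff Cons UNIV_bool)
  have "lie_der (F l) (lie_der Y (word_op F w h)) x =
      (\<Sum>b\<in>UNIV. (if b then 1 else word_weight n w) *s
        lie_der (F l) (if b then word_op F w (lie_der Y h) else word_op F w h) x)"
    unfolding eq by (rule lie_der_sum_right) (simp add: sm)
  then have 1: "lie_der (F l) (lie_der Y (word_op F w h)) x =
      word_op F (l # w) (lie_der Y h) x + word_weight n w *s word_op F (l # w) h x"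
    by (simp add: UNIV_bool)
  have 2: "lie_der (bracket Y (F l)) (word_op F w h) x = n l *s word_op F (l # w) h x"
    by (simp add: lie_der_def eigen vector_scalar_commute)
  have "lie_der Y (word_op F (l # w) h) x =
      lie_der (F l) (lie_der Y (word_op F w h)) x + lie_der (bracket Y (F l)) (word_op F w h) x"
    using lie_der_commutator[OF Y F sm(1), of l] by (simp add: fun_eq_iff algebra_simps)
  then show ?case unfolding 1 2 by (simp add: word_weight_def vector_sadd_rdistrib algebra_simps)
qed

section \<open>Brackets of word series\<close>

lemma sum_word_pairs_convolution:
  fixes e :: "'a list \<Rightarrow> complex^'n"
  shows "(\<Sum>(w, w')\<in>{(w, w'). mset w + mset w' = M}. (\<delta> w * \<delta>' w') *s e (w @ w')) =
    (\<Sum>s\<in>words M. convolution \<delta> \<delta>' s *s e s)"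
proof -
  have "(\<Sum>(w, w')\<in>{(w, w'). mset w + mset w' = M}. (\<delta> w * \<delta>' w') *s e (w @ w')) =
      (\<Sum>(s, i)\<in>Sigma (words M) (\<lambda>s. {..length s}). (\<delta> (take i s) * \<delta>' (drop i s)) *s e s)"
    by (rule sum.reindex_bij_witness[where i = "\<lambda>(s, i). (take i s, drop i s)"
          and j = "\<lambda>(w, w'). (w @ w', length w)"])
       (auto simp: words_def simp flip: mset_append)
  also have "\<dots> = (\<Sum>s\<in>words M. \<Sum>i\<le>length s. (\<delta> (take i s) * \<delta>' (drop i s)) *s e s)"
    by (rule sum.Sigma[symmetric]) (auto simp: finite_words)
  also have "\<dots> = (\<Sum>s\<in>words M. convolution \<delta> \<delta>' s *s e s)"
    by (simp add: convolution_def vec_eq_iff sum_distrib_right)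
  finally show ?thesis .
qed

text \<open>For each \<open>w'\<close> and fixed content of \<open>w\<close>, \<open>primitive_sum_word_op\<close> replaces the first-order derivatives along
the fields \<open>f\<^sub>w\<close> by the operators of the words, and \<open>E\<^sub>w f\<^sub>w\<^sub>' = f\<^sub>w\<^sub>w\<^sub>'\<close>. Only the sum over \<open>w\<close> is equal; the single
terms are not.\<close>

lemma sum_lie_der_word_basis:
  fixes F :: "'a \<Rightarrow> 'n::finite vfield"
  assumes F: "\<And>l. smooth_vf (F l)" and prim: "primitive \<delta>" and nil: "\<delta>' [] = 0"
  shows "(\<Sum>(w, w')\<in>{(w, w'). mset w + mset w' = M}.
      (\<delta> w * \<delta>' w') *s lie_der (word_basis F w) (word_basis F w') x) =
    (\<Sum>s\<in>words M. convolution \<delta> \<delta>' s *s word_basis F s x)"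
proof -
  let ?P = "{(w, w'). mset w + mset w' = M}"
  let ?L = "{w'. mset w' \<subseteq># M}"
  have finL: "finite ?L"
  proof (rule finite_subset)
    show "?L \<subseteq> snd ` ?P"
    proof
      fix w' assume "w' \<in> ?L"
      moreover obtain w where "mset w = M - mset w'" using ex_mset by blast
      ultimately have "(w, w') \<in> ?P" by simp
      then show "w' \<in> snd ` ?P" by force
    qed
    show "finite (snd ` ?P)" by (intro finite_imageI finite_word_pairs)
  qed
  have swap: "(\<Sum>(w, w')\<in>?P. T w w') = (\<Sum>w'\<in>?L. \<Sum>w\<in>words (M - mset w'). T w w')"
    for T :: "'a list \<Rightarrow> 'a list \<Rightarrow> complex^'n"
  proof -
    have "(\<Sum>(w, w')\<in>?P. T w w') = (\<Sum>(w', w)\<in>Sigma ?L (\<lambda>w'. words (M - mset w')). T w w')"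
      by (rule sum.reindex_bij_witness[where i = "\<lambda>(w', w). (w, w')" and j = "\<lambda>(w, w'). (w', w)"])
        (auto simp: words_def)
    also have "\<dots> = (\<Sum>w'\<in>?L. \<Sum>w\<in>words (M - mset w'). T w w')"
      by (rule sum.Sigma[symmetric]) (auto simp: finL finite_words)
    finally show ?thesis .
  qed
  have inner: "(\<Sum>w\<in>words N. (\<delta> w * \<delta>' w') *s lie_der (word_basis F w) (word_basis F w') x) =
      (\<Sum>w\<in>words N. (\<delta> w * \<delta>' w') *s word_basis F (w @ w') x)" for N w'
  proof (cases "N = {#}")
    case True
    have "\<delta> [] = 0" using prim by (simp add: primitive_def)
    then show ?thesis using True by (simp add: words_def)
  next
    case False
    have "(\<Sum>w\<in>words N. (\<delta> w * \<delta>' w') *s lie_der (word_basis F w) (word_basis F w') x) =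
        \<delta>' w' *s (\<Sum>w\<in>words N. \<delta> w *s lie_der (word_basis F w) (word_basis F w') x)"
      by (simp add: vec_eq_iff sum_distrib_left mult_ac)
    also have "\<dots> = \<delta>' w' *s (\<Sum>w\<in>words N. \<delta> w *s word_op F w (word_basis F w') x)"
      using primitive_sum_word_op[where F = F and x = x, OF F prim False smooth_word_basis[of F w', OF F]]
      by (simp add: lie_der_sum_left)
    also have "\<dots> = (\<Sum>w\<in>words N. (\<delta> w * \<delta>' w') *s word_basis F (w @ w') x)"
      by (simp add: vec_eq_iff sum_distrib_left mult_ac word_basis_eq_word_op word_op_append)
    finally show ?thesis .
  qed
  show ?thesis
    unfolding sum_word_pairs_convolution[symmetric] swap inner ..
qed

text \<open>By \<open>lie_der_word_op_eigen\<close>, the derivative of \<open>f\<^sub>w\<close> along \<open>Y\<close> is \<open>E\<^sub>w Y\<close> plus the weighted term, and the sum of the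
\<open>\<delta>\<^sub>w E\<^sub>w Y\<close> is the derivative of \<open>Y\<close> along the word series, which the bracket subtracts.\<close>

lemma bracket_linear_word_series:
  assumes F: "\<And>l. smooth_vf (F l)" and Y: "smooth_vf Y" and prim: "primitive \<delta>" and M: "M \<noteq> {#}"
    and eigen: "\<And>l x. bracket Y (F l) x = n l *s F l x"
  shows "(\<Sum>w\<in>words M. \<delta> w *s bracket Y (word_basis F w) x) =
    (\<Sum>w\<in>words M. (word_weight n w * \<delta> w) *s word_basis F w x)"
proof -
  have "(\<Sum>w\<in>words M. \<delta> w *s lie_der (word_basis F w) Y x) = (\<Sum>w\<in>words M. \<delta> w *s word_op F w Y x)"
    using primitive_sum_word_op[where F = F and x = x, OF F prim M Y] by (simp add: lie_der_sum_left)
  moreover have "lie_der Y (word_basis F w) x = word_op F w Y x + word_weight n w *s word_basis F w x" for w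
    using lie_der_word_op_eigen[OF F Y smooth_vf_id eigen] by (simp add: word_basis_eq_word_op lie_der_id)
  ultimately show ?thesis
    by (simp add: bracket_eq_lie_der vector_ssub_ldistrib vector_add_ldistrib sum_subtractf sum.distrib
        vector_smult_assoc mult.commute)
qed

lemma bracket_antisym: "bracket X Y x = - bracket Y X x"
  by (simp add: bracket_def)

lemma bracket_scale:
  assumes "smooth_vf X" "smooth_vf Y"
  shows "bracket (\<lambda>x. a *s X x) (\<lambda>x. b *s Y x) x = (a * b) *s bracket X Y x"
proof -
  have r: "lie_der Z (\<lambda>x. c *s W x) x = c *s lie_der Z W x" if "smooth_vf W" for Z W c
    using lie_der_sum_right[of "{()}" "\<lambda>_. W" Z "\<lambda>_. c" x] that by simp
  have l: "lie_der (\<lambda>x. c *s Z x) W x = c *s lie_der Z W x" for Z W c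
    by (simp add: lie_der_def vector_scalar_commute)
  show ?thesis
    by (simp add: bracket_eq_lie_der r l assms vector_ssub_ldistrib vector_smult_assoc mult.commute)
qed

text \<open>The bracket has four parts: between the fields \<open>X\<close> and \<open>Y\<close>, between each of them and the opposite word
series, and between the two word series. The first vanishes, and in the other three the coefficient of
\<open>f\<^sub>w\<close> adds up to the difference of the two sides of \<open>coeff\<close>.\<close>

lemma formally_commute_word_series:
  fixes F :: "'a \<Rightarrow> 'n::finite vfield"
  assumes F: "\<And>l. smooth_vf (F l)" and X: "smooth_vf X" and Y: "smooth_vf Y"
    and XY: "\<And>x. bracket X Y x = 0"
    and eigen_X: "\<And>l x. bracket X (F l) x = n l *s F l x"
    and eigen_Y: "\<And>l x. bracket Y (F l) x = n' l *s F l x"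
    and prim: "primitive \<delta>" "primitive \<delta>'"
    and coeff: "\<And>w. convolution \<delta> \<delta>' w + word_weight n w * \<delta>' w = convolution \<delta>' \<delta> w + word_weight n' w * \<delta> w"
  shows "formally_commute (single_vf X + word_series F \<delta>) (single_vf Y + word_series F \<delta>')"
  unfolding formally_commute_def
proof (intro allI)
  fix M :: "'a multiset" and x
  let ?P = "{(w, w'). mset w + mset w' = M}"
  let ?S = "single_vf X + word_series F \<delta>" and ?S' = "single_vf Y + word_series F \<delta>'"
  have nil: "\<delta> [] = 0" "\<delta>' [] = 0" using prim by (simp_all add: primitive_def)
  show "formal_bracket ?S ?S' M x = 0"
  proof (cases "M = {#}")
    case True
    have P: "{(w, w'). mset w + mset w' = ({#} :: 'a multiset)} = {([], [])}" by auto
    have "?S [] = X" "?S' [] = Y"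
      by (simp_all add: single_vf_def word_series_def nil fun_eq_iff)
    then show ?thesis by (simp add: formal_bracket_def True P XY)
  next
    case False
    let ?b = "\<lambda>w. word_basis F w"
    have pair: "bracket (?S w) (?S' w') x =
        (if w = [] then \<delta>' w' *s bracket X (?b w') x else 0) -
        (if w' = [] then \<delta> w *s bracket Y (?b w) x else 0) +
        ((\<delta> w * \<delta>' w') *s lie_der (?b w) (?b w') x - (\<delta>' w' * \<delta> w) *s lie_der (?b w') (?b w) x)"
      if "(w, w') \<in> ?P" for w w'
    proof -
      have S: "?S w = (if w = [] then X else (\<lambda>x. \<delta> w *s ?b w x))"
        and S': "?S' w' = (if w' = [] then Y else (\<lambda>x. \<delta>' w' *s ?b w' x))"
        by (auto simp: single_vf_def word_series_def nil fun_eq_iff)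
      have YX: "bracket (\<lambda>x. \<delta> w *s ?b w x) Y x = - (\<delta> w *s bracket Y (?b w) x)"
        using bracket_scale[OF smooth_word_basis[of F w, OF F] Y, of "\<delta> w" 1 x]
          bracket_antisym[of "?b w" Y x] by simp
      have XY: "bracket X (\<lambda>x. \<delta>' w' *s ?b w' x) x = \<delta>' w' *s bracket X (?b w') x"
        using bracket_scale[OF X smooth_word_basis[of F w', OF F], of 1 "\<delta>' w'" x] by simp
      have WW: "bracket (\<lambda>x. \<delta> w *s ?b w x) (\<lambda>x. \<delta>' w' *s ?b w' x) x =
          (\<delta> w * \<delta>' w') *s lie_der (?b w) (?b w') x - (\<delta>' w' * \<delta> w) *s lie_der (?b w') (?b w) x"
        using bracket_scale[OF smooth_word_basis[of F w, OF F] smooth_word_basis[of F w', OF F],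
            of "\<delta> w" "\<delta>' w'" x]
        by (simp add: bracket_eq_lie_der vector_ssub_ldistrib mult.commute)
      consider "w = []" "w' \<noteq> []" | "w \<noteq> []" "w' = []" | "w \<noteq> []" "w' \<noteq> []"
        using \<open>(w, w') \<in> ?P\<close> False by fastforce
      then show ?thesis
      proof cases
        case 1
        show ?thesis unfolding S S' using 1 XY by (simp add: nil)
      next
        case 2
        show ?thesis unfolding S S' using 2 YX by (simp add: nil)
      next
        case 3
        show ?thesis unfolding S S' using 3 WW by simp
      qed
    qed
    have left: "(\<Sum>(w, w')\<in>?P. if w = [] then T w' else 0) = (\<Sum>w\<in>words M. T w)"
      for T :: "'a list \<Rightarrow> complex^'n"
    proof -
      have "(\<Sum>(w, w')\<in>?P. if w = [] then T w' else 0) = (\<Sum>(w, w')\<in>{[] :: 'a list} \<times> words M. if w = [] then T w' else 0)"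
        by (rule sum.mono_neutral_right) (auto simp: finite_word_pairs words_def split: if_splits)
      then show ?thesis by (simp flip: sum.cartesian_product)
    qed
    have right: "(\<Sum>(w, w')\<in>?P. if w' = [] then T w else 0) = (\<Sum>w\<in>words M. T w)"
      for T :: "'a list \<Rightarrow> complex^'n"
    proof -
      have "(\<Sum>(w, w')\<in>?P. if w' = [] then T w else 0) = (\<Sum>(w, w')\<in>words M \<times> {[] :: 'a list}. if w' = [] then T w else 0)"
        by (rule sum.mono_neutral_right) (auto simp: finite_word_pairs words_def split: if_splits)
      then show ?thesis by (simp flip: sum.cartesian_product)
    qed
    have swapped: "(\<Sum>(w, w')\<in>?P. (\<delta>' w' * \<delta> w) *s lie_der (?b w') (?b w) x) =
        (\<Sum>(w, w')\<in>?P. (\<delta>' w * \<delta> w') *s lie_der (?b w) (?b w') x)"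
      by (rule sum.reindex_bij_witness[where i = "\<lambda>(a, b). (b, a)" and j = "\<lambda>(a, b). (b, a)"])
        (auto simp: add.commute)
    have "formal_bracket ?S ?S' M x = (\<Sum>(w, w')\<in>?P.
        (if w = [] then \<delta>' w' *s bracket X (?b w') x else 0) -
        (if w' = [] then \<delta> w *s bracket Y (?b w) x else 0) +
        ((\<delta> w * \<delta>' w') *s lie_der (?b w) (?b w') x - (\<delta>' w' * \<delta> w) *s lie_der (?b w') (?b w) x))"
      unfolding formal_bracket_def
      by (rule sum.cong[OF refl], simp only: split_paired_all prod.case, erule pair)
    also have "\<dots> = (\<Sum>w\<in>words M. \<delta>' w *s bracket X (?b w) x) - (\<Sum>w\<in>words M. \<delta> w *s bracket Y (?b w) x) +
        ((\<Sum>w\<in>words M. convolution \<delta> \<delta>' w *s ?b w x) - (\<Sum>w\<in>words M. convolution \<delta>' \<delta> w *s ?b w x))"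
      unfolding sum_lie_der_word_basis[where F = F and \<delta> = \<delta> and \<delta>' = \<delta>', OF F prim(1) nil(2), symmetric]
        sum_lie_der_word_basis[where F = F and \<delta> = \<delta>' and \<delta>' = \<delta>, OF F prim(2) nil(1), symmetric] swapped[symmetric]
        left[of "\<lambda>w. \<delta>' w *s bracket X (?b w) x", symmetric]
        right[of "\<lambda>w. \<delta> w *s bracket Y (?b w) x", symmetric]
      by (simp add: case_prod_beta sum.distrib sum_subtractf)
    also have "\<dots> = (\<Sum>w\<in>words M. (convolution \<delta> \<delta>' w + word_weight n w * \<delta>' w -
        (convolution \<delta>' \<delta> w + word_weight n' w * \<delta> w)) *s ?b w x)"
      unfolding bracket_linear_word_series[where F = F and n = n, OF F X prim(2) False eigen_X]
        bracket_linear_word_series[where F = F and n = n', OF F Y prim(1) False eigen_Y]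
      by (simp add: vec_eq_iff algebra_simps flip: sum.distrib sum_subtractf)
    also have "\<dots> = 0" by (simp add: coeff)
    finally show ?thesis .
  qed
qed

section \<open>The normal form\<close>

lemma bracket_lin_comb_left:
  assumes "\<And>j. smooth_vf (G j)" "smooth_vf Y"
  shows "bracket (lin_comb G u) Y x = (\<Sum>j\<in>UNIV. u $ j *s bracket (G j) Y x)"
proof -
  have "lie_der (lin_comb G u) Y x = (\<Sum>j\<in>UNIV. u $ j *s lie_der (G j) Y x)"
    and "lie_der Y (lin_comb G u) x = (\<Sum>j\<in>UNIV. u $ j *s lie_der Y (G j) x)"
    unfolding lin_comb_def by (simp_all add: lie_der_sum_left lie_der_sum_right assms)
  then show ?thesis
    by (simp add: bracket_eq_lie_der vector_ssub_ldistrib sum_subtractf)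
qed

theorem theorem11:
  fixes G :: "'d::finite \<Rightarrow> 'n::finite vfield"
    and F :: "'a::{comm_monoid_add, countable} \<Rightarrow> 'n vfield"
    and \<nu> :: "'d \<Rightarrow> 'a \<Rightarrow> complex"
    and v :: "complex^'d"
    and g :: "'n vfield"
    and f :: "('a, 'n) formal_vf"
  assumes smooth_G: "\<And>j. smooth_vf (G j)"
    and smooth_F: "\<And>l. smooth_vf (F l)"
    and indep_G: "lin_indep_vf G"
    and comm_G: "\<And>j k x. bracket (G j) (G k) x = 0"
    and eigen_F: "\<And>j l x. bracket (G j) (F l) x = \<nu> j l *s F l x"
    and additive_nu: "\<And>j l l'. \<nu> j (l + l') = \<nu> j l + \<nu> j l'"
    and nonresonant: "\<And>l. nu_lin \<nu> v l = 0 \<longleftrightarrow> l = 0"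
    and g_eq: "g = lin_comb G v"
    and f_eq: "f = letter_sum F"
  shows "single_vf g + f = g_tilde G F \<nu> v v + word_series F (beta_bar \<nu> v)
    \<and> formally_commute (g_tilde G F \<nu> v v) (word_series F (beta_bar \<nu> v))
    \<and> formally_commute (g_tilde G F \<nu> v v) (single_vf g + f)
    \<and> formally_commute (word_series F (beta_bar \<nu> v)) (single_vf g + f)
    \<and> (\<forall>u. formally_commute (g_tilde G F \<nu> v v) (g_tilde G F \<nu> v u)
         \<and> formally_commute (word_series F (beta_bar \<nu> v)) (g_tilde G F \<nu> v u))"
proof -
  interpret nonresonant_weight "nu_lin \<nu> v"
    by unfold_locales (simp_all add: additive_nu nonresonant nu_lin_add)
  \<comment> \<open>The field attached to the direction \<open>(c, u)\<close>; those in the theorem have the directions \<open>(0, u)\<close>,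
    \<open>(1, 0)\<close> and \<open>(1, v)\<close>.\<close>
  define S where "S c u = single_vf (lin_comb G u) + word_series F (inf_coeff c (nu_lin \<nu> u))" for c u
  have weight_add: "nu_lin \<nu> u (l + l') = nu_lin \<nu> u l + nu_lin \<nu> u l'" for u l l'
    by (rule nu_lin_add) (rule additive_nu)
  have smooth_lin: "smooth_vf (lin_comb G u)" for u
    unfolding lin_comb_def by (intro smooth_vf_sum smooth_vf_scale smooth_G)
  have commute: "formally_commute (S c u) (S c' u')" for c u c' u'
    unfolding S_def
  proof (rule formally_commute_word_series[OF smooth_F smooth_lin smooth_lin])
    show "bracket (lin_comb G u) (lin_comb G u') x = 0" for x
    proof -
      have "bracket (G j) (lin_comb G u') x = 0" for j
        using bracket_antisym[of "G j" "lin_comb G u'" x]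
        by (simp add: bracket_lin_comb_left smooth_G comm_G)
      then show ?thesis by (simp add: bracket_lin_comb_left smooth_G smooth_lin)
    qed
    show "bracket (lin_comb G u) (F l) x = nu_lin \<nu> u l *s F l x" for u l x
      by (simp add: bracket_lin_comb_left smooth_G smooth_F eigen_F nu_lin_def vec_eq_iff
          sum_distrib_right mult.assoc)
    then show "bracket (lin_comb G u') (F l) x = nu_lin \<nu> u' l *s F l x" for l x .
  qed (rule primitive_inf_coeff inf_coeff_commutator; rule weight_add)+
  have g_tilde: "g_tilde G F \<nu> v u = S 0 u" for u
    by (simp add: g_tilde_def S_def rho_eq_inf_coeff additive_nu nonresonant)
  have nu_lin_0: "nu_lin \<nu> 0 = (\<lambda>_. 0)" by (simp add: nu_lin_def fun_eq_iff)
  have beta: "word_series F (beta_bar \<nu> v) = S 1 0"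
    unfolding S_def nu_lin_0 beta_bar_eq_inf_coeff[OF additive_nu nonresonant]
    by (simp add: lin_comb_def single_vf_def fun_eq_iff)
  have total: "single_vf g + f = S 1 v"
    by (auto simp: fun_eq_iff S_def g_eq f_eq inf_coeff_flow letter_sum_def word_series_def
        split: list.split)
  have "S 1 v w x = S 0 v w x + S 1 0 w x" for w x
  proof -
    have "inf_coeff 1 (nu_lin \<nu> v) w = inf_coeff 0 (nu_lin \<nu> v) w + inf_coeff 1 (nu_lin \<nu> 0) w"
      by (simp add: inf_coeff_add nu_lin_0)
    then show ?thesis
      by (simp add: S_def word_series_def single_vf_def lin_comb_def vector_sadd_rdistrib)
  qed
  then have "S 1 v = S 0 v + S 1 0" by (simp add: fun_eq_iff)
  then show ?thesis
    unfolding g_tilde beta total using commute by blast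
qed

end
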